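(* Every character Hopf algebra $H$ has a linearly ordered set of constitution homogeneous elements $U=\{u_i\mid i\in I\}$ such that the set of all products $$g\,u_1^{n_1}u_2^{n_2}\cdots u_m^{n_m},\qquad g\in G,\quad u_1<u_2<\dots<u_m,\quad 0\le n_i<h(i),$$ forms a basis of $H$. Here, writing $p_{ii}=p_{u_iu_i}$: if $p_{ii}$ is not a root of unity then $h(i)=\infty$; if $p_{ii}=1$ then either $h(i)=\infty$ or $h(i)=l$ is the characteristic of the ground field; if $p_{ii}$ is a primitive $t$-th root of unity, $t\ne1$, then $h(i)=t$.
   Context: $\mathbf k$ is the ground field. A character Hopf algebra $H$ is a Hopf algebra over $\mathbf k$ whose group $G$ of group-like elements is abelian and which is generated as an algebra by $G$ and skew primitive semi-invariants $a_1,\dots,a_n$: $\Delta(a_i)=a_i\otimes1+g_{a_i}\otimes a_i$ with $g_{a_i}\in G$, and $g^{-1}a_ig=\chi^{a_i}(g)a_i$ for $g\in G$, with $\chi^{a_i}:G\to\mathbf k^*$ a character. An element of $H$ is constitution homogeneous if it is the value, under $x_i\mapsto a_i$, of a noncommutative polynomial in $x_1,\dots,x_n$ all of whose monomials have the same degree $m_i$ in each $x_i$. For such an element $u$, put $g_u=\prod_i g_{a_i}^{m_i}$, $\chi^u=\prod_i(\chi^{a_i})^{m_i}$ and $p_{uv}=\chi^u(g_v)$. *)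

theory Defs
  imports
    "HOL-Library.Poly_Mapping"
    "HOL-Library.Extended_Nat"
    "HOL-Computational_Algebra.Computational_Algebra"
begin

section \<open>Tensor squares and tensor cubes\<close>

text \<open>
  A finite list of tuples stands for the sum of the corresponding pure tensors. Every element of
  the tensor square or cube of a vector space \<open>V\<close> is of this form. Two lists
  represent the same tensor iff the corresponding elements of the free vector space on
  \<open>V \<times> V\<close> (or \<open>V \<times> V \<times> V\<close>) differ by an element of the subspace spanned by the
  multilinearity relations; that is, equality is taken in the usual quotient construction.
\<close>

definition free_scale :: "'k::field \<Rightarrow> ('v \<Rightarrow>\<^sub>0 'k) \<Rightarrow> ('v \<Rightarrow>\<^sub>0 'k)"
  where "free_scale c p = Poly_Mapping.map ((*) c) p"

definition formal_sum :: "'v list \<Rightarrow> ('v \<Rightarrow>\<^sub>0 'k::field)"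
  where "formal_sum xs = (\<Sum>x\<leftarrow>xs. Poly_Mapping.single x 1)"

definition tensor2_relations ::
  "('k::field \<Rightarrow> 'a::ab_group_add \<Rightarrow> 'a) \<Rightarrow> ('a \<times> 'a \<Rightarrow>\<^sub>0 'k) set" where
  "tensor2_relations scale =
     {formal_sum [(x + x', y)] - formal_sum [(x, y), (x', y)] | x x' y. True} \<union>
     {formal_sum [(x, y + y')] - formal_sum [(x, y), (x, y')] | x y y'. True} \<union>
     {formal_sum [(scale c x, y)] - free_scale c (formal_sum [(x, y)]) | c x y. True} \<union>
     {formal_sum [(x, scale c y)] - free_scale c (formal_sum [(x, y)]) | c x y. True}"

definition tensor3_relations ::
  "('k::field \<Rightarrow> 'a::ab_group_add \<Rightarrow> 'a) \<Rightarrow> ('a \<times> 'a \<times> 'a \<Rightarrow>\<^sub>0 'k) set" where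
  "tensor3_relations scale =
     {formal_sum [(x + x', y, z)] - formal_sum [(x, y, z), (x', y, z)] | x x' y z. True} \<union>
     {formal_sum [(x, y + y', z)] - formal_sum [(x, y, z), (x, y', z)] | x y y' z. True} \<union>
     {formal_sum [(x, y, z + z')] - formal_sum [(x, y, z), (x, y, z')] | x y z z'. True} \<union>
     {formal_sum [(scale c x, y, z)] - free_scale c (formal_sum [(x, y, z)]) | c x y z. True} \<union>
     {formal_sum [(x, scale c y, z)] - free_scale c (formal_sum [(x, y, z)]) | c x y z. True} \<union>
     {formal_sum [(x, y, scale c z)] - free_scale c (formal_sum [(x, y, z)]) | c x y z. True}"

definition tensor2_eq ::
  "('k::field \<Rightarrow> 'a::ab_group_add \<Rightarrow> 'a) \<Rightarrow> ('a \<times> 'a) list \<Rightarrow> ('a \<times> 'a) list \<Rightarrow> bool" where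
  "tensor2_eq scale xs ys \<longleftrightarrow>
     formal_sum xs - formal_sum ys \<in> module.span free_scale (tensor2_relations scale)"

definition tensor3_eq ::
  "('k::field \<Rightarrow> 'a::ab_group_add \<Rightarrow> 'a) \<Rightarrow> ('a \<times> 'a \<times> 'a) list \<Rightarrow> ('a \<times> 'a \<times> 'a) list \<Rightarrow> bool" where
  "tensor3_eq scale xs ys \<longleftrightarrow>
     formal_sum xs - formal_sum ys \<in> module.span free_scale (tensor3_relations scale)"

lemma lookup_free_scale [simp]:
  "Poly_Mapping.lookup (free_scale c p) x = c * Poly_Mapping.lookup p x"
  unfolding free_scale_def by transfer (auto simp: when_def)

lemma vector_space_free_scale: "vector_space free_scale"
  by unfold_locales (auto intro!: poly_mapping_eqI simp: lookup_add algebra_simps)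

lemma tensor2_eq_bilinear:
  fixes scale :: "'k::field \<Rightarrow> 'a::ab_group_add \<Rightarrow> 'a" and B :: "'a \<Rightarrow> 'a \<Rightarrow> 'a"
  assumes "vector_space scale"
    and add_l: "\<And>x x' y. B (x + x') y = B x y + B x' y"
    and add_r: "\<And>x y y'. B x (y + y') = B x y + B x y'"
    and scale_l: "\<And>c x y. B (scale c x) y = scale c (B x y)"
    and scale_r: "\<And>c x y. B x (scale c y) = scale c (B x y)"
    and eq: "tensor2_eq scale xs ys"
  shows "(\<Sum>(x, y)\<leftarrow>xs. B x y) = (\<Sum>(x, y)\<leftarrow>ys. B x y)"
proof -
  interpret V: vector_space scale by fact
  interpret F: vector_space "free_scale :: 'k \<Rightarrow> ('a \<times> 'a \<Rightarrow>\<^sub>0 'k) \<Rightarrow> _"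
    by (rule vector_space_free_scale)
  define L where "L p = (\<Sum>w\<in>Poly_Mapping.keys p. scale (Poly_Mapping.lookup p w) (B (fst w) (snd w)))"
    for p
  have L_add: "L (p + q) = L p + L q" for p q
    unfolding L_def by (rule setsum_keys_plus_distrib) (auto simp: V.scale_left_distrib)
  have L_scale: "L (free_scale c p) = scale c (L p)" for c p
  proof -
    have "L (free_scale c p) =
        (\<Sum>w\<in>Poly_Mapping.keys p. scale (c * Poly_Mapping.lookup p w) (B (fst w) (snd w)))"
      unfolding L_def by (rule sum.mono_neutral_cong_left) (auto simp: in_keys_iff)
    then show ?thesis by (simp add: L_def V.scale_sum_right)
  qed
  have L_0: "L 0 = 0" by (simp add: L_def)
  have L_diff: "L (p - q) = L p - L q" for p q
    using L_add[of "p - q" q] by (simp add: algebra_simps)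
  have L_single: "L (Poly_Mapping.single w 1) = B (fst w) (snd w)" for w
    by (simp add: L_def)
  have L_sum: "L (formal_sum zs) = (\<Sum>(x, y)\<leftarrow>zs. B x y)" for zs
    by (induction zs) (auto simp: formal_sum_def L_0 L_add L_single)
  have "L p = 0" if "p \<in> F.span (tensor2_relations scale)" for p
    using that
  proof (induction rule: F.span_induct_alt)
    case base
    show ?case by (rule L_0)
  next
    case (step c p q)
    then have "L p = 0"
      by (auto simp: tensor2_relations_def L_diff L_scale L_sum add_l add_r scale_l scale_r)
    then show ?case using step by (simp add: L_add L_scale)
  qed
  from this[OF eq[unfolded tensor2_eq_def]] show ?thesis
    by (simp add: L_diff L_sum)
qed


section \<open>Hopf algebras\<close>

text \<open>
  \<open>comult a\<close> is a list \<open>[(a\<^sub>1, a\<^sub>2), \<dots>]\<close> representing \<open>\<Delta>(a)\<close>, so the list comprehensions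
  below are Sweedler notation. Only the tensor represented by \<open>comult a\<close> matters.
\<close>

locale hopf_algebra = vector_space scale
  for scale :: "'k::field \<Rightarrow> 'a::ring_1 \<Rightarrow> 'a" +
  fixes comult :: "'a \<Rightarrow> ('a \<times> 'a) list"
    and counit :: "'a \<Rightarrow> 'k"
    and antipode :: "'a \<Rightarrow> 'a"
  assumes mult_scale_left: "scale c a * b = scale c (a * b)"
    and mult_scale_right: "a * scale c b = scale c (a * b)"
    and comult_add: "tensor2_eq scale (comult (a + b)) (comult a @ comult b)"
    and comult_scale:
      "tensor2_eq scale (comult (scale c a)) [(scale c x, y). (x, y) \<leftarrow> comult a]"
    and comult_mult:
      "tensor2_eq scale (comult (a * b))
         [(x * x', y * y'). (x, y) \<leftarrow> comult a, (x', y') \<leftarrow> comult b]"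
    and comult_one: "tensor2_eq scale (comult 1) [(1, 1)]"
    and coassoc:
      "tensor3_eq scale
         [(u, v, y). (x, y) \<leftarrow> comult a, (u, v) \<leftarrow> comult x]
         [(x, u, v). (x, y) \<leftarrow> comult a, (u, v) \<leftarrow> comult y]"
    and counit_add: "counit (a + b) = counit a + counit b"
    and counit_scale: "counit (scale c a) = c * counit a"
    and counit_mult: "counit (a * b) = counit a * counit b"
    and counit_one: "counit 1 = 1"
    and counit_left: "(\<Sum>(x, y)\<leftarrow>comult a. scale (counit x) y) = a"
    and counit_right: "(\<Sum>(x, y)\<leftarrow>comult a. scale (counit y) x) = a"
    and antipode_add: "antipode (a + b) = antipode a + antipode b"
    and antipode_scale: "antipode (scale c a) = scale c (antipode a)"
    and antipode_left: "(\<Sum>(x, y)\<leftarrow>comult a. antipode x * y) = scale (counit a) 1"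
    and antipode_right: "(\<Sum>(x, y)\<leftarrow>comult a. x * antipode y) = scale (counit a) 1"
begin

definition grouplikes :: "'a set"
  where "grouplikes = {g. tensor2_eq scale (comult g) [(g, g)] \<and> counit g = 1}"

lemma grouplike_inverse:
  assumes "g \<in> grouplikes"
  shows "antipode g * g = 1" and "g * antipode g = 1"
proof -
  have eq: "tensor2_eq scale (comult g) [(g, g)]" and eps: "counit g = 1"
    using assms by (auto simp: grouplikes_def)
  have "(\<Sum>(x, y)\<leftarrow>comult g. antipode x * y) = (\<Sum>(x, y)\<leftarrow>[(g, g)]. antipode x * y)"
    by (rule tensor2_eq_bilinear[OF vector_space_axioms _ _ _ _ eq])
      (simp_all add: antipode_add antipode_scale mult_scale_left mult_scale_right algebra_simps)
  then show "antipode g * g = 1" using antipode_left[of g] eps by simp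
  have "(\<Sum>(x, y)\<leftarrow>comult g. x * antipode y) = (\<Sum>(x, y)\<leftarrow>[(g, g)]. x * antipode y)"
    by (rule tensor2_eq_bilinear[OF vector_space_axioms _ _ _ _ eq])
      (simp_all add: antipode_add antipode_scale mult_scale_left mult_scale_right algebra_simps)
  then show "g * antipode g = 1" using antipode_right[of g] eps by simp
qed

definition subalgebra :: "'a set \<Rightarrow> bool"
  where "subalgebra B \<longleftrightarrow> subspace B \<and> 1 \<in> B \<and> (\<forall>x\<in>B. \<forall>y\<in>B. x * y \<in> B)"

end


section \<open>Character Hopf algebras\<close>

text \<open>
  The generators are \<open>a i\<close> for \<open>i < n\<close>, with \<open>ga i\<close> and \<open>chi i\<close> the group-like element and the
  character attached to \<open>a i\<close>. The inverse of a group-like \<open>g\<close> is \<open>antipode g\<close>, by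
  \<open>grouplike_inverse\<close>. Values of \<open>chi i\<close> outside \<open>grouplikes\<close> are irrelevant.
\<close>

locale character_hopf_algebra = hopf_algebra scale comult counit antipode
  for scale :: "'k::field \<Rightarrow> 'a::ring_1 \<Rightarrow> 'a"
    and comult :: "'a \<Rightarrow> ('a \<times> 'a) list"
    and counit :: "'a \<Rightarrow> 'k"
    and antipode :: "'a \<Rightarrow> 'a" +
  fixes n :: nat
    and a :: "nat \<Rightarrow> 'a"
    and ga :: "nat \<Rightarrow> 'a"
    and chi :: "nat \<Rightarrow> 'a \<Rightarrow> 'k"
  assumes grouplikes_commute: "g \<in> grouplikes \<Longrightarrow> g' \<in> grouplikes \<Longrightarrow> g * g' = g' * g"
    and ga_grouplike: "i < n \<Longrightarrow> ga i \<in> grouplikes"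
    and skew_primitive: "i < n \<Longrightarrow> tensor2_eq scale (comult (a i)) [(a i, 1), (ga i, a i)]"
    and chi_nonzero: "i < n \<Longrightarrow> g \<in> grouplikes \<Longrightarrow> chi i g \<noteq> 0"
    and chi_mult:
      "i < n \<Longrightarrow> g \<in> grouplikes \<Longrightarrow> g' \<in> grouplikes \<Longrightarrow> chi i (g * g') = chi i g * chi i g'"
    and semi_invariant:
      "i < n \<Longrightarrow> g \<in> grouplikes \<Longrightarrow> antipode g * a i * g = scale (chi i g) (a i)"
    and generated: "subalgebra hull (grouplikes \<union> a ` {..<n}) = UNIV"
begin

text \<open>
  Noncommutative polynomials are finitely supported functions on words over the alphabet
  \<open>{..<n}\<close>. A constitution \<open>m\<close> gives the degree \<open>m i\<close> in the variable \<open>i\<close>.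
\<close>

definition nc_value :: "(nat list \<Rightarrow>\<^sub>0 'k) \<Rightarrow> 'a" where
  "nc_value f =
     (\<Sum>w\<in>Poly_Mapping.keys f. scale (Poly_Mapping.lookup f w) (prod_list (map a w)))"

definition nc_homogeneous :: "(nat \<Rightarrow> nat) \<Rightarrow> (nat list \<Rightarrow>\<^sub>0 'k) \<Rightarrow> bool" where
  "nc_homogeneous m f \<longleftrightarrow>
     (\<forall>w\<in>Poly_Mapping.keys f. set w \<subseteq> {..<n} \<and> (\<forall>i<n. count_list w i = m i))"

definition has_constitution :: "'a \<Rightarrow> (nat \<Rightarrow> nat) \<Rightarrow> bool" where
  "has_constitution u m \<longleftrightarrow> (\<exists>f. nc_homogeneous m f \<and> nc_value f = u)"

definition constitution_group :: "(nat \<Rightarrow> nat) \<Rightarrow> 'a"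
  where "constitution_group m = prod_list (map (\<lambda>i. ga i ^ m i) [0..<n])"

definition constitution_char :: "(nat \<Rightarrow> nat) \<Rightarrow> 'a \<Rightarrow> 'k"
  where "constitution_char m g = (\<Prod>i<n. chi i g ^ m i)"

text \<open>\<open>bichar m m'\<close> is \<open>p\<^sub>u\<^sub>v\<close> for \<open>u\<close>, \<open>v\<close> of constitutions \<open>m\<close>, \<open>m'\<close>.\<close>

definition bichar :: "(nat \<Rightarrow> nat) \<Rightarrow> (nat \<Rightarrow> nat) \<Rightarrow> 'k"
  where "bichar m m' = constitution_char m (constitution_group m')"

end

definition primitive_root_of_unity :: "nat \<Rightarrow> 'k::field \<Rightarrow> bool" where
  "primitive_root_of_unity t p \<longleftrightarrow> t > 0 \<and> p ^ t = 1 \<and> (\<forall>s. 0 < s \<and> s < t \<longrightarrow> p ^ s \<noteq> 1)"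

definition admissible_height :: "'k::field \<Rightarrow> enat \<Rightarrow> bool" where
  "admissible_height p h \<longleftrightarrow>
     ((\<forall>t>0. p ^ t \<noteq> 1) \<longrightarrow> h = \<infinity>) \<and>
     (p = 1 \<longrightarrow> h = \<infinity> \<or> (CHAR('k) > 0 \<and> h = enat CHAR('k))) \<and>
     (\<forall>t. t \<noteq> 1 \<and> primitive_root_of_unity t p \<longrightarrow> h = enat t)"


section \<open>Restricted PBW products\<close>

text \<open>
  A PBW word over the linearly ordered set \<open>(U, r)\<close> is the list of the pairs \<open>(u\<^sub>i, n\<^sub>i)\<close> of a
  product \<open>u\<^sub>1\<^bsup>n\<^sub>1\<^esup> \<cdots> u\<^sub>m\<^bsup>n\<^sub>m\<^esup>\<close> with \<open>u\<^sub>1 < \<dots> < u\<^sub>m\<close>. Factors with exponent \<open>0\<close> are left out, so that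
  each formal product occurs exactly once.
\<close>

definition pbw_words :: "'a set \<Rightarrow> 'a rel \<Rightarrow> ('a \<Rightarrow> enat) \<Rightarrow> ('a \<times> nat) list set" where
  "pbw_words U r h =
     {ws. sorted_wrt (\<lambda>x y. fst x \<noteq> fst y \<and> (fst x, fst y) \<in> r) ws \<and>
          (\<forall>(u, k)\<in>set ws. u \<in> U \<and> 0 < k \<and> enat k < h u)}"

definition pbw_product :: "'a::ring_1 \<times> ('a \<times> nat) list \<Rightarrow> 'a"
  where "pbw_product = (\<lambda>(g, ws). g * prod_list (map (\<lambda>(u, k). u ^ k) ws))"

text \<open>
  The products form a basis as a family: besides being linearly independent and spanning,
  distinct formal products have distinct values.
\<close>

definition (in hopf_algebra) pbw_basis :: "'a set \<Rightarrow> 'a rel \<Rightarrow> ('a \<Rightarrow> enat) \<Rightarrow> bool" where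
  "pbw_basis U r h \<longleftrightarrow>
     inj_on pbw_product (grouplikes \<times> pbw_words U r h) \<and>
     independent (pbw_product ` (grouplikes \<times> pbw_words U r h)) \<and>
     span (pbw_product ` (grouplikes \<times> pbw_words U r h)) = UNIV"

end

theory Submission
  imports Defs "HOL-Library.List_Lexorder"
begin

text \<open>
  The PBW generators can be chosen to be monomials. Order the words in the \<open>a\<^sub>i\<close> first by length
  and then by the reverse of the lexicographic order, and call a word normal if it is not a
  combination, with coefficients in the group algebra, of preceding words. The products \<open>g w\<close> with
  \<open>w\<close> normal form a basis. Every word is a unique product \<open>l\<^sub>1 ^ k\<^sub>1 \<cdots> l\<^sub>m ^ k\<^sub>m\<close> of powers of decreasing Lyndon
  words, and this product is the lexicographically largest shuffle of its factors, occurring only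
  once. Pairing the coproduct with functionals dual to normal words therefore shows that
  the product is normal as soon as all the powers are. In the same way, \<open>l\<^sup>i\<^sup>+\<^sup>j\<close> is the largest
  shuffle of \<open>l\<^sup>i\<close> and \<open>l\<^sup>j\<close>, with a Gaussian binomial coefficient in \<open>p\<^sub>l\<^sub>l\<close> as multiplicity;
  hence the least \<open>s\<close> such that \<open>l\<^sup>s\<close> is not normal is one of the numbers
  \<open>1, t, t p, t p\<^sup>2, \<dots>\<close>, where \<open>t\<close> is the order of \<open>p\<^sub>l\<^sub>l\<close> and \<open>p\<close> the characteristic.
  Expanding the exponents with respect to these place values \<open>e\<close>, the generators are the normal
  words \<open>l\<^sup>e\<close>.
\<close>

subsection \<open>Lyndon words and shuffles\<close>

text \<open>A PBW product is literally a group-like times the word obtained by multiplying out its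
  factors. The basis property therefore amounts to a bijection between ordered PBW words and normal
  words, once the latter are known to give a basis.

  The height of \<open>l^e\<close> is the ratio of the next place value to \<open>e\<close>. It
  depends on p_ll alone; the relations of H only decide which places occur. If some power of
  \<open>l\<close> is not normal, the least such exponent \<open>s\<close> is a place value, and the
  normal powers \<open>l^k\<close>, those with k < s, are exactly the ones whose expansions use only
  places below \<open>s\<close>. The scalar of u = \<open>l^e\<close> is p_uu = p_ll^(e^2). It is
  p_ll for e = 1 and 1 for every larger place, and wherever p_ll^e = 1 the ratio to the next place,
  if there is one, is the characteristic. Hence the cases for h.

  The group algebra is the obstacle to independence: normality of \<open>w\<close> does not at once
  forbid a relation in which a noninvertible combination of group-likes stands in front of the
  leading word \<open>w\<close>. A pairing that reads the group-like off the right tensor factor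
  excludes this.\<close>

lemma append_less_append_iff:
  fixes u v :: "'a::linorder list"
  assumes "length u = length v"
  shows "u @ x < v @ y \<longleftrightarrow> u < v \<or> u = v \<and> x < y"
  using assms by (induction u v rule: list_induct2) auto

lemma append_le_append_iff:
  fixes u v :: "'a::linorder list"
  assumes "length u = length v"
  shows "u @ x \<le> v @ y \<longleftrightarrow> u < v \<or> u = v \<and> x \<le> y"
  using assms by (induction u v rule: list_induct2) auto

lemma le_append: "u \<le> u @ (v :: 'a::linorder list)"
  by (induction u) auto

text \<open>The length condition rules out that \<open>u\<close> is a proper prefix of
  \<open>v\<close>, so the two words differ at a common position.\<close>

lemma less_append_right:
  fixes u v :: "'a::linorder list"
  assumes "u < v" "length v \<le> length u"
  shows "u @ x < v @ y"
  using assms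
proof (induction u arbitrary: v)
  case (Cons a u)
  then show ?case by (cases v) auto
qed simp

section \<open>Lexicographic comparison of shuffles\<close>

lemma shuffles_Nil_right [simp]: "shuffles xs [] = {xs}"
  by (cases xs) auto

lemma shuffles_append_left:
  "z \<in> shuffles x y \<Longrightarrow> z @ w \<in> shuffles (x @ w) y"
proof (induction z arbitrary: x y)
  case Nil
  then show ?case by auto
next
  case (Cons a z)
  then consider x' where "x = a # x'" "z \<in> shuffles x' y"
    | y' where "y = a # y'" "z \<in> shuffles x y'"
    by (cases x; cases y) (auto simp: Cons_in_shuffles_iff)
  then show ?case
    by cases (use Cons.IH in \<open>auto intro: Cons_in_shuffles_leftI Cons_in_shuffles_rightI\<close>)
qed

lemma shuffles_appendE:
  assumes "p @ r \<in> shuffles x y"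
  obtains x1 x2 y1 y2 where "x = x1 @ x2" "y = y1 @ y2" "p \<in> shuffles x1 y1" "r \<in> shuffles x2 y2"
  using assms
proof (induction p arbitrary: x y thesis)
  case Nil
  then show ?case by (metis Nil_in_shufflesI append_Nil)
next
  case (Cons a p)
  from Cons.prems(2) consider x' where "x = a # x'" "p @ r \<in> shuffles x' y"
    | y' where "y = a # y'" "p @ r \<in> shuffles x y'"
    by (cases x; cases y) (auto simp: Cons_in_shuffles_iff)
  then show ?case
  proof cases
    case 1
    from Cons.IH[OF _ 1(2)] obtain x1 x2 y1 y2 where
      *: "x' = x1 @ x2" "y = y1 @ y2" "p \<in> shuffles x1 y1" "r \<in> shuffles x2 y2" by metis
    show ?thesis
      by (rule Cons.prems(1)[of "a # x1" x2 y1 y2]) (use * 1 in \<open>auto intro: Cons_in_shuffles_leftI\<close>)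
  next
    case 2
    from Cons.IH[OF _ 2(2)] obtain x1 x2 y1 y2 where
      *: "x = x1 @ x2" "y' = y1 @ y2" "p \<in> shuffles x1 y1" "r \<in> shuffles x2 y2" by metis
    show ?thesis
      by (rule Cons.prems(1)[of x1 x2 "a # y1" y2]) (use * 2 in \<open>auto intro: Cons_in_shuffles_rightI\<close>)
  qed
qed

text \<open>The letters of \<open>x'\<close> take the positions that the letters of \<open>x\<close>
  have in \<open>z\<close>. At the first difference a larger letter appears and decides the
  comparison, so the remainders may be shuffled in any way; \<open>splice\<close> is one
  choice.\<close>

lemma shuffles_strict_mono:
  fixes x x' y z :: "'a::linorder list"
  assumes "z \<in> shuffles x y" "length x = length x'" "x < x'"
  obtains z' where "z' \<in> shuffles x' y" "z < z'"
  using assms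
proof (induction z arbitrary: x x' y thesis)
  case (Cons a z)
  from Cons.prems(2) consider x0 where "x = a # x0" "z \<in> shuffles x0 y"
    | y0 where "y = a # y0" "z \<in> shuffles x y0"
    by (cases x; cases y) (auto simp: Cons_in_shuffles_iff)
  then show ?case
  proof cases
    case 1
    with Cons.prems(3) obtain b x0' where x': "x' = b # x0'" "length x0 = length x0'"
      by (cases x') auto
    show ?thesis
    proof (cases "a < b")
      case True
      show ?thesis
        by (rule Cons.prems(1)[of "b # splice x0' y"])
          (use True x' in \<open>auto intro: Cons_in_shuffles_leftI\<close>)
    next
      case False
      with Cons.prems(4) 1 x' have "a = b" "x0 < x0'" by auto
      with Cons.IH[OF _ 1(2) x'(2)] obtain z' where "z' \<in> shuffles x0' y" "z < z'" by metis
      with \<open>a = b\<close> show ?thesis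
        by (intro Cons.prems(1)[of "b # z'"]) (use x' in \<open>auto intro: Cons_in_shuffles_leftI\<close>)
    qed
  next
    case 2
    with Cons.IH[OF _ 2(2) Cons.prems(3,4)] obtain z' where "z' \<in> shuffles x' y0" "z < z'" by metis
    with 2 show ?thesis
      by (intro Cons.prems(1)[of "a # z'"]) (auto intro: Cons_in_shuffles_rightI)
  qed
qed auto

text \<open>Strict monotonicity is applied once in each argument. The equality case matters later:
  among the pairs that are componentwise at most (\<open>x\<close>, \<open>y\<close>), only
  (\<open>x\<close>, \<open>y\<close>) itself can contribute to the top word.\<close>

lemma shuffles_le_max:
  fixes x y u v z w :: "'a::linorder list"
  assumes z: "z \<in> shuffles u v" and len: "length u = length x" "length v = length y"
    and le: "u \<le> x" "v \<le> y" and max: "\<And>z. z \<in> shuffles x y \<Longrightarrow> z \<le> w"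
  shows "z \<le> w" and "z = w \<Longrightarrow> u = x \<and> v = y"
proof -
  have *: "z < w" if "u \<noteq> x \<or> v \<noteq> y"
  proof (cases "u = x")
    case True
    with that le have "v < y" by auto
    from z have "z \<in> shuffles v u" by (simp add: shuffles_commutes)
    from shuffles_strict_mono[OF this len(2) \<open>v < y\<close>]
    obtain z' where "z' \<in> shuffles y u" "z < z'" by blast
    with max[of z'] True show ?thesis by (auto simp: shuffles_commutes)
  next
    case False
    with le have "u < x" by auto
    from shuffles_strict_mono[OF z len(1) this]
    obtain z1 where z1: "z1 \<in> shuffles x v" "z < z1" by blast
    show ?thesis
    proof (cases "v = y")
      case True
      with z1 max[of z1] show ?thesis by auto
    next
      case False
      with le have "v < y" by auto
      from z1 have "z1 \<in> shuffles v x" by (simp add: shuffles_commutes)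
      from shuffles_strict_mono[OF this len(2) \<open>v < y\<close>]
      obtain z' where "z' \<in> shuffles y x" "z1 < z'" by blast
      with max[of z'] z1 show ?thesis by (auto simp: shuffles_commutes)
    qed
  qed
  show "z \<le> w" using * max[of z] z by (cases "u = x \<and> v = y") auto
  show "z = w \<Longrightarrow> u = x \<and> v = y" using * by auto
qed

text \<open>The two words trade their tails behind \<open>u\<close>. A letter of \<open>u\<close> is
  copied; a letter \<open>a\<close> of \<open>y\<close> is answered by the first letter of
  \<open>x\<close>, which is at least \<open>a\<close>. If it is larger, the comparison is decided.
  If it equals \<open>a\<close>, then \<open>a\<close> joins the prefix \<open>u\<close> and the
  recursion goes on with both tails shortened.\<close>

lemma shuffles_exchange:
  fixes x y z u :: "'a::linorder list"
  assumes "z \<in> shuffles (u @ x) y" "y \<le> x"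
  obtains z' where "z' \<in> shuffles x (u @ y)" "z \<le> z'"
  using assms
proof (induction z arbitrary: u x y thesis)
  case Nil
  then show ?case by auto
next
  case (Cons a z)
  show ?case
  proof (cases u)
    case Nil
    with Cons.prems show ?thesis by (intro Cons.prems(1)[of "a # z"]) auto
  next
    case u: (Cons c u0)
    from Cons.prems(2) consider "a = c" "z \<in> shuffles (u0 @ x) y"
      | y0 where "y = a # y0" "z \<in> shuffles (u @ x) y0"
      using u by (cases y) (auto simp: Cons_in_shuffles_iff)
    then show ?thesis
    proof cases
      case 1
      from Cons.IH[OF _ 1(2) Cons.prems(3)]
      obtain z' where "z' \<in> shuffles x (u0 @ y)" "z \<le> z'" by metis
      with 1 u show ?thesis
        by (intro Cons.prems(1)[of "a # z'"]) (auto intro: Cons_in_shuffles_rightI)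
    next
      case 2
      with Cons.prems(3) obtain b x0 where x: "x = b # x0" by (cases x) auto
      show ?thesis
      proof (cases "a < b")
        case True
        with x show ?thesis
          by (intro Cons.prems(1)[of "b # splice x0 (u @ y)"]) (auto intro: Cons_in_shuffles_leftI)
      next
        case False
        with Cons.prems(3) 2 x have "a = b" "y0 \<le> x0" by auto
        have "z \<in> shuffles ((u @ [a]) @ x0) y0" using 2(2) x \<open>a = b\<close> by simp
        from Cons.IH[OF _ this \<open>y0 \<le> x0\<close>]
        obtain z' where "z' \<in> shuffles x0 ((u @ [a]) @ y0)" "z \<le> z'" by metis
        with \<open>a = b\<close> x 2 show ?thesis
          by (intro Cons.prems(1)[of "a # z'"]) (auto intro: Cons_in_shuffles_leftI)
      qed
    qed
  qed
qed

text \<open>If the shuffle starts with a letter of \<open>y\<close> equal to the first letter of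
  \<open>s\<close>, \<open>shuffles_exchange\<close> replaces it by a shuffle that starts with the
  letter of \<open>s\<close>. The condition is imposed on all nonempty suffixes of \<open>s\<close>
  because that form passes to the tail of \<open>s\<close>.\<close>

lemma shuffles_le_append:
  fixes s y z :: "'a::linorder list"
  assumes "z \<in> shuffles s y" "\<And>s1 s2. s = s1 @ s2 \<Longrightarrow> s2 \<noteq> [] \<Longrightarrow> y \<le> s2"
  shows "z \<le> s @ y"
  using assms
proof (induction s arbitrary: z)
  case Nil
  then show ?case by auto
next
  case (Cons c s)
  have suf: "y \<le> s2" if "s = s1 @ s2" "s2 \<noteq> []" for s1 s2
    using Cons.prems(2)[of "c # s1" s2] that by auto
  have y: "y \<le> c # s" using Cons.prems(2)[of "[]" "c # s"] by auto
  from Cons.prems(1) consider z1 where "z = c # z1" "z1 \<in> shuffles s y"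
    | d y1 z1 where "z = d # z1" "y = d # y1" "z1 \<in> shuffles (c # s) y1"
    by (cases z; cases y) (auto simp: Cons_in_shuffles_iff)
  then show ?case
  proof cases
    case 1
    with Cons.IH[OF 1(2) suf] show ?thesis by auto
  next
    case 2
    show ?thesis
    proof (cases "d < c")
      case False
      with y 2 have "d = c" "y1 \<le> s" by auto
      from shuffles_exchange[of z1 "[c]" s y1] 2(3) \<open>y1 \<le> s\<close>
      obtain z' where "z' \<in> shuffles s (c # y1)" "z1 \<le> z'" by auto
      moreover from this 2 \<open>d = c\<close> have "z' \<le> s @ y" by (intro Cons.IH suf) auto
      ultimately show ?thesis using 2 \<open>d = c\<close> by auto
    qed (use 2 in auto)
  qed
qed

section \<open>Lyndon words and shuffles of their powers\<close>

definition lyndon :: "'a::linorder list \<Rightarrow> bool" where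
  "lyndon l \<longleftrightarrow> l \<noteq> [] \<and> (\<forall>u v. l = u @ v \<longrightarrow> u \<noteq> [] \<longrightarrow> v \<noteq> [] \<longrightarrow> l < v)"

definition wpow :: "'a list \<Rightarrow> nat \<Rightarrow> 'a list" where
  "wpow l k = concat (replicate k l)"

lemma wpow_0 [simp]: "wpow l 0 = []"
  and wpow_Suc [simp]: "wpow l (Suc k) = l @ wpow l k"
  by (simp_all add: wpow_def)

lemma wpow_add: "wpow l (i + j) = wpow l i @ wpow l j"
  by (simp add: wpow_def replicate_add)

lemma wpow_mult: "wpow l (i * j) = wpow (wpow l i) j"
  by (induction j) (simp_all add: wpow_add)

lemma length_wpow [simp]: "length (wpow l k) = k * length l"
  by (induction k) auto

lemma lyndon_not_Nil: "lyndon l \<Longrightarrow> l \<noteq> []"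
  by (simp add: lyndon_def)

lemma lyndon_suffix_le: "lyndon l \<Longrightarrow> l = u @ v \<Longrightarrow> v \<noteq> [] \<Longrightarrow> l \<le> v"
  unfolding lyndon_def by (cases "u = []") (auto simp: less_imp_le)

text \<open>This controls the first \<open>length l\<close> letters of a shuffle. Completing
  \<open>z\<close> by \<open>x2\<close> gives a shuffle of \<open>l\<close> and \<open>y\<close>,
  which is at most \<open>l @ y\<close>. Equality \<open>z = l\<close> then forces
  \<open>x2 \<le> y \<le> l\<close>, whereas a proper nonempty suffix of \<open>l\<close> exceeds
  \<open>l\<close>. So a first block \<open>l\<close> cannot be mixed from two nonempty
  pieces.\<close>

lemma lyndon_shuffle_prefix:
  fixes l :: "'a::linorder list"
  assumes l: "lyndon l" and x: "l = x @ x2" and z: "z \<in> shuffles x y" "length z = length l"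
    and y: "y \<le> l"
  shows "z \<le> l" and "z = l \<Longrightarrow> x = [] \<or> y = []"
proof -
  have "z @ x2 \<in> shuffles l y"
    using shuffles_append_left[OF z(1)] x by simp
  then have "z @ x2 \<le> l @ y"
    by (rule shuffles_le_append) (use l y lyndon_suffix_le in \<open>blast intro: order_trans\<close>)
  then have *: "z < l \<or> z = l \<and> x2 \<le> y"
    using z(2) by (simp add: append_le_append_iff)
  then show "z \<le> l" by auto
  show "x = [] \<or> y = []" if "z = l"
  proof (rule ccontr)
    assume "\<not> (x = [] \<or> y = [])"
    with length_shuffles[OF z(1)] z(2) x have "x \<noteq> []" "x2 \<noteq> []" by auto
    with l x have "l < x2" unfolding lyndon_def by blast
    with * that y show False by auto
  qed
qed

lemma wpow_suffix_ge:
  fixes l :: "'a::linorder list"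
  assumes "lyndon l" "wpow l k = u @ v" "v \<noteq> []"
  shows "l \<le> v"
  using assms(2,3)
proof (induction k arbitrary: u)
  case (Suc k)
  from Suc.prems(1) consider s where "u = l @ s" "wpow l k = s @ v"
    | s where "l = u @ s" "v = s @ wpow l k"
    by (auto simp: append_eq_append_conv2)
  then show ?case
  proof cases
    case 1
    with Suc show ?thesis by blast
  next
    case 2
    show ?thesis
    proof (cases "s = []")
      case True
      with 2 Suc.IH[of "[]"] Suc.prems show ?thesis by auto
    next
      case False
      with lyndon_suffix_le[OF assms(1)] 2 have "l \<le> s" by blast
      with 2 show ?thesis using le_append[of s] by (auto intro: order_trans)
    qed
  qed
qed auto

lemma shuffles_wpow_le:
  fixes l v z :: "'a::linorder list"
  assumes "lyndon l" "v < l" "z \<in> shuffles (wpow l k) v"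
  shows "z \<le> wpow l k @ v"
  using assms(3)
proof (rule shuffles_le_append)
  fix s1 s2 assume "wpow l k = s1 @ s2" "s2 \<noteq> []"
  with wpow_suffix_ge[OF assms(1)] assms(2) show "v \<le> s2" by fastforce
qed

lemma wpow_prefix:
  assumes "wpow l (Suc k) = x1 @ x2" "length x1 \<le> length l"
  obtains s where "l = x1 @ s" "x2 = s @ wpow l k"
  using assms by (auto simp: append_eq_append_conv2)

text \<open>\<open>shuffles_le_append\<close> does not apply directly: the suffix \<open>l\<close>
  of \<open>wpow l i\<close> is smaller than \<open>wpow l j\<close> when j > 1. Instead one block
  of length \<open>length l\<close> is split off. Either it is below \<open>l\<close>, or it equals
  \<open>l\<close> and is taken entirely from one of the two powers.\<close>

lemma shuffles_wpow_wpow_le: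
  fixes l z :: "'a::linorder list"
  assumes "lyndon l" "z \<in> shuffles (wpow l i) (wpow l j)"
  shows "z \<le> wpow l (i + j)"
  using assms(2)
proof (induction "i + j" arbitrary: i j z)
  case 0
  then show ?case by auto
next
  case (Suc m)
  show ?case
  proof (cases "i = 0 \<or> j = 0")
    case True
    with Suc.prems show ?thesis by auto
  next
    case False
    then obtain i' j' where ij: "i = Suc i'" "j = Suc j'" by (metis not0_implies_Suc)
    define p r where "p = take (length l) z" and "r = drop (length l) z"
    have "length z = (i + j) * length l"
      using length_shuffles[OF Suc.prems] by (simp add: add_mult_distrib)
    then have p: "length p = length l" "z = p @ r"
      using ij by (simp_all add: p_def r_def)
    from Suc.prems p(2) obtain x1 x2 y1 y2 where xy: "wpow l i = x1 @ x2" "wpow l j = y1 @ y2"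
      "p \<in> shuffles x1 y1" "r \<in> shuffles x2 y2" by (metis shuffles_appendE)
    from length_shuffles[OF xy(3)] p have len: "length x1 \<le> length l" "length y1 \<le> length l" by auto
    obtain s where s: "l = x1 @ s" "x2 = s @ wpow l i'"
      using wpow_prefix xy(1) len(1) ij by metis
    obtain t where t: "l = y1 @ t" "y2 = t @ wpow l j'"
      using wpow_prefix xy(2) len(2) ij by metis
    have y1: "y1 \<le> l" using le_append[of y1 t] t by simp
    note * = lyndon_shuffle_prefix[OF assms(1) s(1) xy(3) p(1) y1]
    have w: "wpow l (i + j) = l @ wpow l (i' + j)" "wpow l (i + j) = l @ wpow l (i + j')"
      using ij by auto
    show ?thesis
    proof (cases "p = l")
      case False
      with *(1) have "p < l" by auto
      then show ?thesis
        unfolding p(2) w(1) using p(1) by (simp add: append_le_append_iff)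
    next
      case True
      with *(2) consider "x1 = []" | "y1 = []" by blast
      then show ?thesis
      proof cases
        case 1
        with xy(3) True t have "t = []" by auto
        with 1 xy t have "r \<in> shuffles (wpow l i) (wpow l j')" by simp
        with Suc.hyps(1)[of i j' r] Suc.hyps(2) ij have "r \<le> wpow l (i + j')" by simp
        then show ?thesis unfolding p(2) w(2) True by (simp add: append_le_append_iff)
      next
        case 2
        with xy(3) True s have "s = []" by auto
        with 2 xy s have "r \<in> shuffles (wpow l i') (wpow l j)" by simp
        with Suc.hyps(1)[of i' j r] Suc.hyps(2) ij have "r \<le> wpow l (i' + j)" by simp
        then show ?thesis unfolding p(2) w(1) True by (simp add: append_le_append_iff)
      qed
    qed
  qed
qed

subsection \<open>Factorization into Lyndon words\<close>

lemma less_append_not_prefix: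
  fixes u v :: "'a::linorder list"
  assumes "u < v" "\<nexists>s. v = u @ s"
  shows "u @ x < v @ y"
  using assms
proof (induction u arbitrary: v)
  case (Cons a u)
  then show ?case by (cases v) auto
qed simp

text \<open>A suffix starting inside \<open>u\<close> begins with some \<open>s > u\<close>, and one
  inside \<open>v\<close> is at least \<open>v\<close>. So everything rests on
  \<open>u @ v < v\<close>. In the critical case v = u w, the Lyndon property of \<open>v\<close>
  gives v < w, and prefixing \<open>u\<close> gives u v < u w = v.\<close>

lemma lyndon_append:
  fixes u v :: "'a::linorder list"
  assumes u: "lyndon u" and v: "lyndon v" and "u < v"
  shows "lyndon (u @ v)"
proof -
  have uv: "u @ v < v"
  proof (cases "\<exists>w. v = u @ w")
    case True
    then obtain w where w: "v = u @ w" by blast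
    with \<open>u < v\<close> have "w \<noteq> []" by auto
    with v w lyndon_not_Nil[OF u] have "v < w" unfolding lyndon_def by blast
    with w show ?thesis by (simp add: append_less_append_iff)
  next
    case False
    with less_append_not_prefix[OF \<open>u < v\<close>, of v "[]"] show ?thesis by simp
  qed
  show ?thesis
    unfolding lyndon_def
  proof (intro conjI allI impI)
    show "u @ v \<noteq> []" using lyndon_not_Nil[OF u] by simp
    fix a b assume ab: "u @ v = a @ b" "a \<noteq> []" "b \<noteq> []"
    then consider s where "a = u @ s" "v = s @ b" | s where "u = a @ s" "b = s @ v" "s \<noteq> []"
      by (metis append_Nil append_Nil2 append_eq_append_conv2)
    then show "u @ v < b"
    proof cases
      case 1
      with lyndon_suffix_le[OF v 1(2)] ab uv show ?thesis by auto
    next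
      case 2
      with u ab have "u < s" unfolding lyndon_def by blast
      with 2 show ?thesis using less_append_right[of u s v v] by auto
    qed
  qed
qed

lemma lyndon_singleton: "lyndon [c]"
  by (auto simp: lyndon_def Cons_eq_append_conv)

text \<open>The Chen-Fox-Lyndon factorization; its existence and uniqueness are proved
  below.\<close>

definition lyndon_fact :: "'a::linorder list list \<Rightarrow> bool" where
  "lyndon_fact ls \<longleftrightarrow> (\<forall>l\<in>set ls. lyndon l) \<and> sorted_wrt (\<ge>) ls"

lemma lyndon_fact_Cons:
  "lyndon_fact (l # ls) \<longleftrightarrow> lyndon l \<and> (\<forall>l'\<in>set ls. l' \<le> l) \<and> lyndon_fact ls"
  by (auto simp: lyndon_fact_def)

text \<open>A new first factor smaller than its successor fuses with it into a longer Lyndon word,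
  until the factors are nonincreasing.\<close>

lemma lyndon_fact_merge:
  fixes l :: "'a::linorder list"
  assumes "lyndon l" "lyndon_fact ls"
  obtains ls' where "lyndon_fact ls'" "concat ls' = l @ concat ls"
  using assms
proof (induction ls arbitrary: l thesis)
  case Nil
  then show ?case by (intro Nil(1)[of "[l]"]) (auto simp: lyndon_fact_def)
next
  case (Cons m ls)
  show ?case
  proof (cases "l < m")
    case True
    with Cons.prems have "lyndon (l @ m)" by (intro lyndon_append) (auto simp: lyndon_fact_Cons)
    from Cons.IH[OF _ this] Cons.prems show ?thesis by (auto simp: lyndon_fact_Cons)
  next
    case False
    with Cons.prems show ?thesis
      by (intro Cons.prems(1)[of "l # m # ls"]) (auto simp: lyndon_fact_Cons)
  qed
qed

lemma lyndon_fact_exists: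
  fixes w :: "'a::linorder list"
  obtains ls where "lyndon_fact ls" "concat ls = w"
proof (induction w arbitrary: thesis)
  case Nil
  then show ?case by (intro Nil[of "[]"]) (auto simp: lyndon_fact_def)
next
  case (Cons c w)
  then obtain ls where "lyndon_fact ls" "concat ls = w" by metis
  with lyndon_fact_merge[OF lyndon_singleton[of c]] Cons.prems show ?case by (metis append_Cons append_Nil)
qed

text \<open>A longer Lyndon prefix \<open>l\<close> would extend beyond the first factor
  \<open>m\<close> and end with a nonempty prefix \<open>p\<close> of some later factor
  \<open>m'\<close>. Then l < p \<le> m' \<le> m \<le> l, a contradiction. Applied to two
  factorizations of one word, this makes their first factors equally long.\<close>

lemma lyndon_prefix_le:
  fixes l :: "'a::linorder list"
  assumes "lyndon l" "lyndon_fact ls" "l @ r = concat ls" "ls \<noteq> []"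
  shows "length l \<le> length (hd ls)"
proof (rule ccontr)
  assume *: "\<not> ?thesis"
  obtain m ms where ls: "ls = m # ms" using assms(4) by (cases ls) auto
  have "m \<noteq> []" using assms(2) ls by (auto simp: lyndon_fact_Cons lyndon_not_Nil)
  have fin: "\<exists>s p m'. l = s @ p \<and> s \<noteq> [] \<and> p \<noteq> [] \<and> m' \<in> set ms \<and> (\<exists>q. m' = p @ q)"
  proof -
    \<comment> \<open>Here \<open>m'\<close> is the factor in which \<open>t\<close> ends, and
      \<open>p\<close> is the part of \<open>t\<close> lying in it.\<close>
    have gen: "\<exists>s p m'. t = s @ p \<and> p \<noteq> [] \<and> m' \<in> set ms \<and> (\<exists>q. m' = p @ q)"
      if "t @ r = concat ms" "t \<noteq> []" for t and ms :: "'a list list"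
      using that
    proof (induction ms arbitrary: t)
      case (Cons a ms)
      then consider (1) "\<exists>q. a = t @ q" | (2) s where "t = a @ s" "s @ r = concat ms" "s \<noteq> []"
        by (metis append.right_neutral append_eq_append_conv2 concat.simps(2))
      then show ?case
      proof cases
        case 1
        with Cons.prems show ?thesis by (intro exI[of _ "[]"] exI[of _ t] exI[of _ a]) auto
      next
        case 2
        from Cons.IH[OF 2(2,3)] obtain s' p m' where
          "s = s' @ p \<and> p \<noteq> [] \<and> m' \<in> set ms \<and> (\<exists>q. m' = p @ q)" by blast
        with 2 show ?thesis by (intro exI[of _ "a @ s'"] exI[of _ p] exI[of _ m']) auto
      qed
    qed auto
    from assms(3) ls * obtain t where t: "l = m @ t" "t @ r = concat ms" "t \<noteq> []"
      by (auto simp: append_eq_append_conv2)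
    from gen[OF t(2,3)] obtain s p m' where "t = s @ p \<and> p \<noteq> [] \<and> m' \<in> set ms \<and> (\<exists>q. m' = p @ q)"
      by blast
    with t \<open>m \<noteq> []\<close> show ?thesis by (intro exI[of _ "m @ s"] exI[of _ p] exI[of _ m']) auto
  qed
  then obtain s p m' q where p: "l = s @ p" "s \<noteq> []" "p \<noteq> []" "m' \<in> set ms" "m' = p @ q" by blast
  then have "l < p" using assms(1) unfolding lyndon_def by blast
  also have "p \<le> m'" using le_append p by auto
  also have "m' \<le> m" using assms(2) ls p by (auto simp: lyndon_fact_Cons)
  also have "m \<le> l"
    using assms(3) ls * le_append[of m] by (auto simp: append_eq_append_conv2)
  finally show False by simp
qed

lemma lyndon_fact_unique:
  fixes ls ms :: "'a::linorder list list"
  assumes "lyndon_fact ls" "lyndon_fact ms" "concat ls = concat ms"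
  shows "ls = ms"
  using assms
proof (induction ls arbitrary: ms)
  case Nil
  then show ?case by (cases ms) (auto simp: lyndon_fact_Cons lyndon_not_Nil)
next
  case (Cons l ls)
  then obtain m ms' where ms: "ms = m # ms'"
    by (cases ms) (auto simp: lyndon_fact_Cons lyndon_not_Nil)
  have "length l \<le> length m"
    using lyndon_prefix_le[of l ms "concat ls"] Cons.prems ms by (auto simp: lyndon_fact_Cons)
  moreover have "length m \<le> length l"
    using lyndon_prefix_le[of m "l # ls" "concat ms'"] Cons.prems ms by (auto simp: lyndon_fact_Cons)
  ultimately have "l = m" "concat ls = concat ms'" using Cons.prems ms by auto
  with Cons ms show ?case by (auto simp: lyndon_fact_Cons)
qed

text \<open>This is \<open>concat_less_lyndon\<close> with the Lyndon word replaced by a suffix of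
  one: the condition passes to suffixes of \<open>t\<close>, so the induction can strip a factor
  that is a prefix of \<open>t\<close>.\<close>

lemma concat_less_suffix:
  fixes t :: "'a::linorder list"
  assumes "t \<noteq> []" "\<And>s u m. t = s @ u \<Longrightarrow> u \<noteq> [] \<Longrightarrow> m \<in> set ms \<Longrightarrow> m < u"
  shows "concat ms < t"
  using assms
proof (induction ms arbitrary: t)
  case Nil
  then show ?case by (cases t) auto
next
  case (Cons m ms)
  have m: "m < t" using Cons.prems(2)[of "[]" t m] Cons.prems(1) by auto
  show ?case
  proof (cases "\<exists>s. t = m @ s")
    case True
    then obtain s where s: "t = m @ s" by blast
    have "concat ms < s"
    proof (rule Cons.IH)
      show "s \<noteq> []" using m s by auto
      show "m' < u" if "s = s' @ u" "u \<noteq> []" "m' \<in> set ms" for s' u m'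
        using Cons.prems(2)[of "m @ s'" u m'] that s by auto
    qed
    with s show ?thesis by (simp add: append_less_append_iff)
  next
    case False
    from less_append_not_prefix[OF m this, of "concat ms" "[]"] show ?thesis by simp
  qed
qed

lemma concat_less_lyndon:
  fixes l :: "'a::linorder list"
  assumes "lyndon l" "\<And>m. m \<in> set ms \<Longrightarrow> m < l"
  shows "concat ms < l"
  by (rule concat_less_suffix)
    (use assms lyndon_not_Nil lyndon_suffix_le in \<open>blast intro: less_le_trans\<close>)+

subsection \<open>Gaussian binomial coefficients\<close>

text \<open>\<open>gbin q i j\<close> is the Gaussian binomial coefficient of \<open>i + j\<close> over \<open>i\<close>.\<close>

fun gbin :: "'k::field \<Rightarrow> nat \<Rightarrow> nat \<Rightarrow> 'k" where
  "gbin q 0 j = 1"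
| "gbin q (Suc i) 0 = 1"
| "gbin q (Suc i) (Suc j) = q ^ Suc j * gbin q i (Suc j) + gbin q (Suc i) j"

lemma gbin_0_right [simp]: "gbin q i 0 = 1"
  by (cases i) auto

text \<open>The quotient formula with denominators cleared, hence valid also when these vanish. The
  recursion of \<open>gbin\<close> is not symmetric, so the identity and its mirror image go through
  one induction, each relying on both at smaller arguments.\<close>

lemma gbin_absorb:
  "(q ^ Suc i - 1) * gbin q (Suc i) j = (q ^ (Suc i + j) - 1) * gbin q i j \<and>
   (q ^ Suc j - 1) * gbin q i (Suc j) = (q ^ (i + Suc j) - 1) * gbin q i j"
proof (induction "i + j" arbitrary: i j rule: less_induct)
  case less
  have *: "(q ^ Suc i - 1) * gbin q (Suc i) j = (q ^ (Suc i + j) - 1) * gbin q i j"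
    if IH: "j = 0 \<or> (q ^ Suc i - 1) * gbin q (Suc i) (j - 1) = (q ^ (Suc i + (j - 1)) - 1) * gbin q i (j - 1) \<and>
      (q ^ j - 1) * gbin q i j = (q ^ (i + j) - 1) * gbin q i (j - 1)" for i j
  proof (cases j)
    case (Suc j')
    with IH have 1: "(q ^ Suc i - 1) * gbin q (Suc i) j' = (q ^ (Suc i + j') - 1) * gbin q i j'"
      and 2: "(q ^ j - 1) * gbin q i j = (q ^ (i + j) - 1) * gbin q i j'" by auto
    have "(q ^ Suc i - 1) * gbin q (Suc i) j =
        (q ^ Suc i - 1) * q ^ j * gbin q i j + (q ^ Suc i - 1) * gbin q (Suc i) j'"
      using Suc by (simp add: algebra_simps)
    also have "\<dots> = (q ^ Suc i - 1) * q ^ j * gbin q i j + (q ^ j - 1) * gbin q i j"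
      using 1 2 Suc by simp
    also have "\<dots> = (q ^ (Suc i + j) - 1) * gbin q i j"
      by (simp add: algebra_simps power_add)
    finally show ?thesis .
  qed auto
  have **: "(q ^ Suc j - 1) * gbin q i (Suc j) = (q ^ (i + Suc j) - 1) * gbin q i j"
    if IH: "i = 0 \<or> (q ^ i - 1) * gbin q i j = (q ^ (i + j) - 1) * gbin q (i - 1) j \<and>
      (q ^ Suc j - 1) * gbin q (i - 1) (Suc j) = (q ^ (i + j) - 1) * gbin q (i - 1) j" for i j
  proof (cases i)
    case (Suc i')
    with IH have 1: "(q ^ i - 1) * gbin q i j = (q ^ (i + j) - 1) * gbin q i' j"
      and 2: "(q ^ Suc j - 1) * gbin q i' (Suc j) = (q ^ (i + j) - 1) * gbin q i' j" by auto
    have "(q ^ Suc j - 1) * gbin q i (Suc j) =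
        q ^ Suc j * ((q ^ Suc j - 1) * gbin q i' (Suc j)) + (q ^ Suc j - 1) * gbin q i j"
      using Suc by (simp add: algebra_simps)
    also have "\<dots> = q ^ Suc j * ((q ^ i - 1) * gbin q i j) + (q ^ Suc j - 1) * gbin q i j"
      using 1 2 by simp
    also have "\<dots> = (q ^ (i + Suc j) - 1) * gbin q i j"
      by (simp add: algebra_simps power_add)
    finally show ?thesis .
  qed auto
  have "j = 0 \<or> (q ^ Suc i - 1) * gbin q (Suc i) (j - 1) = (q ^ (Suc i + (j - 1)) - 1) * gbin q i (j - 1) \<and>
      (q ^ j - 1) * gbin q i j = (q ^ (i + j) - 1) * gbin q i (j - 1)"
    using less[of i "j - 1"] by (cases j) auto
  moreover have "i = 0 \<or> (q ^ i - 1) * gbin q i j = (q ^ (i + j) - 1) * gbin q (i - 1) j \<and>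
      (q ^ Suc j - 1) * gbin q (i - 1) (Suc j) = (q ^ (i + j) - 1) * gbin q (i - 1) j"
    using less[of "i - 1" j] by (cases i) auto
  ultimately show ?case using * ** by blast
qed

text \<open>These are the exponents with (x + y)^e = x^e + y^e whenever y x = q x y. The exponent 1
  qualifies vacuously.\<close>

definition gbin_vanish :: "'k::field \<Rightarrow> nat \<Rightarrow> bool" where
  "gbin_vanish q e \<longleftrightarrow> 0 < e \<and> (\<forall>i j. 0 < i \<longrightarrow> 0 < j \<longrightarrow> i + j = e \<longrightarrow> gbin q i j = 0)"

lemma gbin_vanish_1: "gbin_vanish q 1"
  by (auto simp: gbin_vanish_def)

lemma gbin_vanish_pos: "gbin_vanish q e \<Longrightarrow> 0 < e"
  by (simp add: gbin_vanish_def)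

lemma gbin_vanish_power:
  assumes "gbin_vanish q e" "e > 1"
  shows "q ^ e = 1"
proof -
  have "gbin q (Suc 0) (e - 1) = 0" using assms by (auto simp: gbin_vanish_def)
  with gbin_absorb[of q 0 "e - 1"] assms show ?thesis by simp
qed

lemma gbin_vanish_order:
  assumes "primitive_root_of_unity t q"
  shows "gbin_vanish q t"
  unfolding gbin_vanish_def
proof (intro conjI allI impI)
  show "t > 0" using assms by (simp add: primitive_root_of_unity_def)
  fix i j assume ij: "0 < i" "0 < j" "i + j = t"
  have "(q ^ i - 1) * gbin q i j = (q ^ (i + j) - 1) * gbin q (i - 1) j"
    using gbin_absorb[of q "i - 1" j] ij by simp
  moreover have "q ^ i \<noteq> 1" "q ^ t = 1" using assms ij by (auto simp: primitive_root_of_unity_def)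
  ultimately show "gbin q i j = 0" using ij by simp
qed

text \<open>For y x = q x y, the powers x^e and y^e are central because q^e = 1. The formula
  compares coefficients in (x + y)^(i+j) = (x^e + y^e) (x + y)^(i+j-e). The proof stays with the
  Pascal recursion: both sides satisfy it, and at i + j = e with i, j > 0 the left side vanishes by
  assumption while neither shift is possible.\<close>

lemma gbin_shift:
  fixes q :: "'k::field"
  assumes e: "gbin_vanish q e" "q ^ e = 1" and "e \<le> i + j"
  shows "gbin q i j = (if e \<le> j then gbin q i (j - e) else 0) + (if e \<le> i then gbin q (i - e) j else 0)"
  using assms(3)
proof (induction "i + j" arbitrary: i j rule: less_induct)
  case less
  have epos: "e > 0" using e by (simp add: gbin_vanish_def)
  show ?case
  proof (cases "i = 0 \<or> j = 0")
    case True
    with less.prems epos show ?thesis by auto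
  next
    case False
    then obtain i' j' where ij: "i = Suc i'" "j = Suc j'" by (metis not0_implies_Suc)
    show ?thesis
    proof (cases "i + j = e")
      case True
      then have "gbin q i j = 0" using e(1) ij by (auto simp: gbin_vanish_def simp del: gbin.simps)
      with True ij show ?thesis by simp
    next
      case gt: False
      have *: "gbin q i j = q ^ j * gbin q i' j + gbin q i j'" using ij by simp
      have 1: "gbin q i' j = (if e \<le> j then gbin q i' (j - e) else 0) + (if e \<le> i' then gbin q (i' - e) j else 0)"
        by (rule less.hyps) (use ij gt less.prems in auto)
      have 2: "gbin q i j' = (if e \<le> j' then gbin q i (j' - e) else 0) + (if e \<le> i then gbin q (i - e) j' else 0)"
        by (rule less.hyps) (use ij gt less.prems in auto)
      have A: "(if e \<le> j then gbin q i (j - e) else 0) =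
          q ^ j * (if e \<le> j then gbin q i' (j - e) else 0) + (if e \<le> j' then gbin q i (j' - e) else 0)"
      proof (cases "e \<le> j")
        case True
        then have "q ^ j = q ^ (j - e)" using e(2) by (metis le_add_diff_inverse mult.left_neutral power_add)
        with True gt ij show ?thesis by (cases "j - e") (auto simp: Suc_diff_le)
      qed (use ij in auto)
      have B: "(if e \<le> i then gbin q (i - e) j else 0) =
          q ^ j * (if e \<le> i' then gbin q (i' - e) j else 0) + (if e \<le> i then gbin q (i - e) j' else 0)"
      proof (cases "e \<le> i")
        case True
        with gt ij show ?thesis by (cases "i - e") (auto simp: Suc_diff_le)
      qed (use ij in auto)
      show ?thesis unfolding * 1 2 A B by (simp add: algebra_simps)
    qed
  qed
qed

lemma gbin_shift_below:
  fixes q :: "'k::field"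
  assumes "gbin_vanish q e" "q ^ e = 1" "i < e"
  shows "gbin q i (e * c) = 1"
proof (induction c)
  case (Suc c)
  from gbin_shift[OF assms(1,2), of i "e * Suc c"] assms(3) Suc show ?case by simp
qed simp

text \<open>If r = e' mod e were positive, the coefficient at (r, e' - r) would have to vanish. It
  is 1 by \<open>gbin_shift_below\<close>, since only the second argument admits shifts by
  \<open>e\<close>.\<close>

lemma gbin_vanish_dvd:
  assumes e: "gbin_vanish q e" and e': "gbin_vanish q e'" and "e < e'"
  shows "e dvd e'"
proof (cases "e = 1")
  case False
  with e have "q ^ e = 1" by (intro gbin_vanish_power) (auto simp: gbin_vanish_def)
  have "e > 0" using e by (simp add: gbin_vanish_def)
  then have "gbin q (e' mod e) (e * (e' div e)) = 1"
    using e \<open>q ^ e = 1\<close> by (intro gbin_shift_below) auto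
  moreover have "e * (e' div e) > 0" using \<open>e < e'\<close> \<open>e > 0\<close> by (simp add: div_greater_zero_iff)
  moreover have "e' mod e + e * (e' div e) = e'" by simp
  ultimately have "e' mod e = 0" using e' by (auto simp: gbin_vanish_def)
  then show ?thesis by auto
qed simp

text \<open>With \<open>gbin_shift_nondvd\<close>, this gives the coefficients of (x^e + y^e)^c:
  ordinary binomials at multiples of \<open>e\<close>, zero elsewhere.\<close>

lemma gbin_shift_multiple:
  fixes q :: "'k::field"
  assumes "gbin_vanish q e" "q ^ e = 1"
  shows "gbin q (e * a) (e * b) = of_nat ((a + b) choose a)"
proof (induction "a + b" arbitrary: a b)
  case (Suc m)
  have epos: "e > 0" using assms by (simp add: gbin_vanish_def)
  show ?case
  proof (cases "a = 0 \<or> b = 0")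
    case False
    then obtain a' b' where ab: "a = Suc a'" "b = Suc b'" by (metis not0_implies_Suc)
    have "gbin q (e * a) (e * b) = gbin q (e * a) (e * b') + gbin q (e * a') (e * b)"
      using gbin_shift[OF assms, of "e * a" "e * b"] ab epos by simp
    also have "\<dots> = of_nat ((a + b') choose a) + of_nat ((a' + b) choose a')"
      by (intro arg_cong2[of _ _ _ _ "(+)"] Suc.hyps(1)) (use Suc.hyps(2) ab in auto)
    also have "\<dots> = of_nat ((a + b) choose a)"
      using ab by simp
    finally show ?thesis .
  qed auto
qed simp

lemma gbin_shift_nondvd:
  fixes q :: "'k::field"
  assumes "gbin_vanish q e" "q ^ e = 1" "\<not> e dvd i" "i + j = e * c"
  shows "gbin q i j = 0"
  using assms(3,4)
proof (induction c arbitrary: i j)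
  case (Suc c)
  from Suc.prems have i: "gbin q (i - e) j = 0" if "e \<le> i"
    using that by (intro Suc.IH) (auto simp flip: le_imp_diff_is_add dest: dvd_diffD)
  from Suc.prems have j: "gbin q i (j - e) = 0" if "e \<le> j"
    using that by (intro Suc.IH) auto
  from gbin_shift[OF assms(1,2), of i j] Suc.prems i j show ?case by auto
qed auto

text \<open>Write e' = e c. The coefficient at (e, e (c-1)) is c choose 1, so c vanishes in the
  field and is a multiple of the characteristic p. Conversely e p is itself a place, because p
  divides its inner binomials; minimality gives c = p.\<close>

lemma gbin_vanish_next_char:
  fixes q :: "'k::field"
  assumes e: "gbin_vanish q e" "q ^ e = 1" and e': "gbin_vanish q e'" "e < e'"
    and least: "\<And>d. gbin_vanish q d \<Longrightarrow> e < d \<Longrightarrow> e' \<le> d"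
  shows "CHAR('k) > 0" and "e' = e * CHAR('k)"
proof -
  have epos: "e > 0" using e by (simp add: gbin_vanish_def)
  obtain c where c: "e' = e * c" using gbin_vanish_dvd[OF e(1) e'] by blast
  with e'(2) have "c > 1" by (cases c) auto
  have "gbin q (e * 1) (e * (c - 1)) = of_nat ((1 + (c - 1)) choose 1)"
    by (rule gbin_shift_multiple[OF e])
  moreover have "gbin q (e * 1) (e * (c - 1)) = 0"
    using e'(1) c \<open>c > 1\<close> epos unfolding gbin_vanish_def
    by (metis add.commute distrib_left le_add_diff_inverse2 less_imp_le mult.right_neutral nat_0_less_mult_iff zero_less_diff)
  ultimately have "(of_nat c :: 'k) = 0" using \<open>c > 1\<close> by simp
  then have dvd: "CHAR('k) dvd c" by (simp add: of_nat_eq_0_iff_char_dvd)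
  with \<open>c > 1\<close> show pos: "CHAR('k) > 0" by (metis dvd_0_left_iff gr0I not_less0)
  then have prime: "prime CHAR('k)" by (rule prime_CHAR_semidom)
  have "gbin_vanish q (e * CHAR('k))"
    unfolding gbin_vanish_def
  proof (intro conjI allI impI)
    show "0 < e * CHAR('k)" using epos pos by simp
    fix i j assume ij: "0 < i" "0 < j" "i + j = e * CHAR('k)"
    show "gbin q i j = 0"
    proof (cases "e dvd i")
      case True
      then obtain a where a: "i = e * a" by blast
      with ij have "e dvd j" by (metis dvd_add_right_iff dvd_triv_left)
      then obtain b where b: "j = e * b" by blast
      from ij a b epos have ab: "a + b = CHAR('k)" "0 < a" "0 < b"
        by (auto simp flip: distrib_left)
      have "CHAR('k) dvd CHAR('k) choose a"
        by (rule dvd_choose_prime) (use ab prime in auto)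
      then have "(of_nat ((a + b) choose a) :: 'k) = 0"
        using ab by (simp add: of_nat_eq_0_iff_char_dvd)
      then show ?thesis unfolding a b gbin_shift_multiple[OF e] .
    next
      case False
      from gbin_shift_nondvd[OF e this ij(3)] show ?thesis .
    qed
  qed
  moreover have "e < e * CHAR('k)" using epos prime_gt_1_nat[OF prime] by simp
  ultimately have "e' \<le> e * CHAR('k)" by (rule least)
  moreover have "e * CHAR('k) \<le> e'" unfolding c using dvd \<open>c > 1\<close> by (simp add: dvd_imp_le)
  ultimately show "e' = e * CHAR('k)" by simp
qed

text \<open>The radix at place \<open>e\<close>, that is, the bound for its digit, and later the
  height of the generator \<open>l^e\<close>. The division is exact by
  \<open>gbin_vanish_dvd\<close>; infinity means that no larger place exists.\<close>

definition next_vanish :: "'k::field \<Rightarrow> nat \<Rightarrow> enat" where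
  "next_vanish q e =
     (if \<exists>d>e. gbin_vanish q d then enat ((LEAST d. e < d \<and> gbin_vanish q d) div e) else \<infinity>)"

lemma next_vanishE:
  fixes q :: "'k::field"
  assumes "gbin_vanish q e"
  obtains "next_vanish q e = \<infinity>" "\<And>d. gbin_vanish q d \<Longrightarrow> d \<le> e"
  | c where "next_vanish q e = enat c" "gbin_vanish q (e * c)" "c > 1"
    "\<And>d. gbin_vanish q d \<Longrightarrow> e < d \<Longrightarrow> e * c \<le> d"
proof (cases "\<exists>d>e. gbin_vanish q d")
  case True
  define d where "d = (LEAST d. e < d \<and> gbin_vanish q d)"
  have d: "e < d" "gbin_vanish q d"
    using LeastI_ex[of "\<lambda>d. e < d \<and> gbin_vanish q d"] True unfolding d_def by auto
  have "d \<le> d'" if "gbin_vanish q d'" "e < d'" for d'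
    unfolding d_def by (rule Least_le) (use that in auto)
  moreover obtain c where c: "d = e * c" using gbin_vanish_dvd[OF assms d(2,1)] by blast
  moreover have "c > 1" using c d(1) by (cases c) auto
  moreover have "next_vanish q e = enat c"
    using True c gbin_vanish_pos[OF assms] by (simp add: next_vanish_def flip: d_def)
  ultimately show ?thesis using d that(2) by blast
next
  case False
  then show ?thesis using that(1) by (auto simp: next_vanish_def) (meson not_less)
qed

text \<open>The exponent \<open>e * e\<close> comes from p_uu for u = \<open>l^e\<close>. A place e
  > 1 forces q^e = 1, so either p_uu = 1 and the next ratio is governed by the characteristic, or e
  = 1 and p_uu = q, where the next place is the order of q.\<close>

lemma admissible_height_next_vanish:
  fixes q :: "'k::field"
  assumes e: "gbin_vanish q e"
  shows "admissible_height (q ^ (e * e)) (next_vanish q e)"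
proof (cases "q ^ e = 1")
  case True
  then have 1: "q ^ (e * e) = 1" by (simp add: power_mult)
  have "next_vanish q e = \<infinity> \<or> (CHAR('k) > 0 \<and> next_vanish q e = enat CHAR('k))"
    using e
  proof (cases rule: next_vanishE)
    case (2 c)
    have "e < e * c" using 2(3) gbin_vanish_pos[OF e] by simp
    from gbin_vanish_next_char[OF e True 2(2) this 2(4)] gbin_vanish_pos[OF e] 2(1)
    show ?thesis by simp
  qed auto
  moreover have "\<not> (t \<noteq> 1 \<and> primitive_root_of_unity t (1 :: 'k))" for t
    unfolding primitive_root_of_unity_def by (metis less_one nat_neq_iff power_one zero_less_one)
  ultimately show ?thesis unfolding 1 admissible_height_def by auto
next
  case False
  with gbin_vanish_power[OF e] gbin_vanish_pos[OF e] have e1: "e = 1" by fastforce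
  have q1: "q \<noteq> 1" using False by auto
  have *: "next_vanish q 1 = \<infinity>" if "\<forall>t>0. q ^ t \<noteq> 1"
    using gbin_vanish_1[of q]
  proof (cases rule: next_vanishE)
    case (2 c)
    with gbin_vanish_power[of q c] that show ?thesis by auto
  qed auto
  have **: "next_vanish q 1 = enat t" if t: "t \<noteq> 1" "primitive_root_of_unity t q" for t
    using gbin_vanish_1[of q]
  proof (cases rule: next_vanishE)
    case 1
    from 1(2)[OF gbin_vanish_order[OF t(2)]] t show ?thesis
      by (auto simp: primitive_root_of_unity_def)
  next
    case (2 c)
    have "t > 1" using t by (auto simp: primitive_root_of_unity_def)
    with 2(4)[OF gbin_vanish_order[OF t(2)]] have "c \<le> t" by simp
    moreover have "q ^ c = 1" using gbin_vanish_power[of q c] 2 by simp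
    ultimately have "c = t" using t 2(3) unfolding primitive_root_of_unity_def
      by (metis le_neq_implies_less less_trans zero_less_one)
    with 2 show ?thesis by simp
  qed
  show ?thesis unfolding e1 admissible_height_def using * ** q1 by auto
qed

subsection \<open>Mixed radix expansions\<close>

text \<open>By \<open>gbin_vanish_dvd\<close>, each of the place values \<open>{e. gbin_vanish q e}\<close> divides the next one.\<close>

definition expansion :: "'k::field \<Rightarrow> (nat \<times> nat) list \<Rightarrow> bool" where
  "expansion q ds \<longleftrightarrow> sorted_wrt (\<lambda>x y. fst x < fst y) ds \<and>
     (\<forall>(e, d)\<in>set ds. gbin_vanish q e \<and> 0 < d \<and> enat d < next_vanish q e)"

definition expansion_value :: "(nat \<times> nat) list \<Rightarrow> nat" where
  "expansion_value ds = (\<Sum>(e, d)\<leftarrow>ds. e * d)"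

lemma expansion_value_simps [simp]:
  "expansion_value [] = 0"
  "expansion_value (ds @ [(e, d)]) = expansion_value ds + e * d"
  by (simp_all add: expansion_value_def)

lemma expansion_snoc:
  "expansion q (ds @ [(e, d)]) \<longleftrightarrow> expansion q ds \<and> (\<forall>x\<in>set ds. fst x < e) \<and>
     gbin_vanish q e \<and> 0 < d \<and> enat d < next_vanish q e"
  by (auto simp: expansion_def sorted_wrt_append)

text \<open>As in ordinary digit notation: the lower digits add up to less than \<open>e\<close>,
  and e * d + e does not go beyond the next place.\<close>

lemma expansion_value_less:
  assumes "expansion q ds" "gbin_vanish q e'" "\<forall>x\<in>set ds. fst x < e'"
  shows "expansion_value ds < e'"
  using assms
proof (induction ds arbitrary: e' rule: rev_induct)
  case Nil
  then show ?case using gbin_vanish_pos by simp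
next
  case (snoc x ds)
  obtain e d where x: "x = (e, d)" by (cases x)
  with snoc.prems have *: "expansion q ds" "\<forall>x\<in>set ds. fst x < e" "gbin_vanish q e" "e < e'"
    "enat d < next_vanish q e" by (auto simp: expansion_snoc)
  have "expansion_value ds < e" by (rule snoc.IH) (use * in auto)
  moreover have "e * d + e \<le> e'" using *(3)
  proof (cases rule: next_vanishE)
    case 1
    with *(4) snoc.prems(2) show ?thesis by fastforce
  next
    case (2 c)
    with * have "Suc d \<le> c" by simp
    then have "e * Suc d \<le> e * c" by (rule mult_le_mono2)
    also have "\<dots> \<le> e'" using 2(4) snoc.prems(2) *(4) by blast
    finally show ?thesis by simp
  qed
  ultimately show ?case using x by simp
qed

lemma expansion_unique:
  assumes "expansion q ds" "expansion q ds'" "expansion_value ds = expansion_value ds'"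
  shows "ds = ds'"
  using assms
proof (induction ds arbitrary: ds' rule: rev_induct)
  case Nil
  show ?case
  proof (cases ds' rule: rev_cases)
    case (snoc ys y)
    with Nil show ?thesis by (cases y) (auto simp: expansion_snoc dest: gbin_vanish_pos)
  qed simp
next
  case (snoc x ds)
  obtain e d where x: "x = (e, d)" by (cases x)
  have ed: "expansion q ds" "\<forall>x\<in>set ds. fst x < e" "gbin_vanish q e" "0 < d"
    "enat d < next_vanish q e" using snoc.prems(1) x by (auto simp: expansion_snoc)
  have small: "expansion_value ds < e" using expansion_value_less[OF ed(1,3,2)] .
  show ?case
  proof (cases ds' rule: rev_cases)
    case Nil
    with snoc.prems x ed gbin_vanish_pos[OF ed(3)] show ?thesis by simp
  next
    case (snoc ys y)
    obtain e' d' where y: "y = (e', d')" by (cases y)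
    have ed': "expansion q ys" "\<forall>x\<in>set ys. fst x < e'" "gbin_vanish q e'" "0 < d'"
      "enat d' < next_vanish q e'" using snoc.prems(2) snoc y by (auto simp: expansion_snoc)
    have small': "expansion_value ys < e'" using expansion_value_less[OF ed'(1,3,2)] .
    have eq: "expansion_value ds + e * d = expansion_value ys + e' * d'"
      using snoc.prems(3) snoc x y by simp
    have "\<not> e < e'"
    proof
      assume "e < e'"
      then have "expansion_value (ds @ [(e, d)]) < e'"
        using snoc.prems(1) x ed ed' by (intro expansion_value_less) auto
      then show False using eq ed'(4) by (cases d') auto
    qed
    moreover have "\<not> e' < e"
    proof
      assume "e' < e"
      then have "expansion_value (ys @ [(e', d')]) < e"
        using snoc.prems(2) snoc y ed ed' by (intro expansion_value_less) auto
      then show False using eq ed(4) by (cases d) auto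
    qed
    ultimately have "e = e'" by simp
    with eq have "(expansion_value ds + e * d) mod e = (expansion_value ys + e * d') mod e" by simp
    with small small' \<open>e = e'\<close> have v: "expansion_value ds = expansion_value ys" by simp
    with eq \<open>e = e'\<close> gbin_vanish_pos[OF ed(3)] have "d = d'" by simp
    moreover from snoc.IH[OF ed(1) ed'(1) v] have "ds = ys" .
    ultimately show ?thesis using snoc x y \<open>e = e'\<close> by simp
  qed
qed

lemma expansion_exists:
  obtains ds where "expansion q ds" "expansion_value ds = k" "\<And>x. x \<in> set ds \<Longrightarrow> fst x \<le> k"
proof (induction k arbitrary: thesis rule: less_induct)
  case (less k)
  show ?case
  proof (cases "k = 0")
    case True
    then show ?thesis by (intro less.prems[of "[]"]) (auto simp: expansion_def)
  next
    case False
    define E where "E = {e. gbin_vanish q e \<and> e \<le> k}"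
    have E: "finite E" "1 \<in> E" using False gbin_vanish_1 by (auto simp: E_def)
    define e where "e = Max E"
    have "e \<in> E" unfolding e_def using E by (intro Max_in) auto
    then have e: "gbin_vanish q e" "e \<le> k" by (auto simp: E_def)
    have max: "d \<le> e" if "gbin_vanish q d" "d \<le> k" for d
      unfolding e_def using E that by (intro Max_ge) (auto simp: E_def)
    have epos: "e > 0" using gbin_vanish_pos e by blast
    then have mod: "k mod e < e" by simp
    then have "k mod e < k" using e by simp
    from less.IH[OF this] obtain ds where ds: "expansion q ds" "expansion_value ds = k mod e"
      "\<And>x. x \<in> set ds \<Longrightarrow> fst x \<le> k mod e" by metis
    have "enat (k div e) < next_vanish q e" using e(1)
    proof (cases rule: next_vanishE)
      case (2 c)
      have "\<not> e * c \<le> k" using max[OF 2(2)] 2(3) epos by auto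
      then have "k div e < c" using epos by (metis div_less_iff_less_mult mult.commute not_le)
      with 2 show ?thesis by simp
    qed auto
    moreover have "0 < k div e" using e epos by (simp add: div_greater_zero_iff)
    moreover have "\<forall>x\<in>set ds. fst x < e" using ds(3) mod by fastforce
    ultimately have "expansion q (ds @ [(e, k div e)])" using ds(1) e(1) by (simp add: expansion_snoc)
    then show ?thesis
      by (rule less.prems) (use ds e \<open>k mod e < k\<close> in \<open>fastforce\<close>)+
  qed
qed

subsection \<open>Linear forms\<close>

definition lin_form :: "('k::field \<Rightarrow> 'a::ab_group_add \<Rightarrow> 'a) \<Rightarrow> ('a \<Rightarrow> 'k) \<Rightarrow> bool" where
  "lin_form s f \<longleftrightarrow> (\<forall>x y. f (x + y) = f x + f y) \<and> (\<forall>c x. f (s c x) = c * f x)"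

lemma lin_form_add: "lin_form s f \<Longrightarrow> f (x + y) = f x + f y"
  and lin_form_scale: "lin_form s f \<Longrightarrow> f (s c x) = c * f x"
  by (auto simp: lin_form_def)

lemma lin_form_0: "lin_form s f \<Longrightarrow> f 0 = 0"
  using lin_form_add[of s f 0 0] by (metis add.right_neutral add_cancel_left_right)

lemma lin_form_diff: "lin_form s f \<Longrightarrow> f (x - y) = f x - f y"
  using lin_form_add[of s f "x - y" y] by (simp add: algebra_simps)

lemma lin_form_sum: "lin_form s f \<Longrightarrow> f (\<Sum>i\<in>I. h i) = (\<Sum>i\<in>I. f (h i))"
  by (induction I rule: infinite_finite_induct) (auto simp: lin_form_0 lin_form_add)

context vector_space
begin

lemma lin_form_eq_on_span:
  assumes "lin_form scale f" "lin_form scale h" "\<And>x. x \<in> S \<Longrightarrow> f x = h x" "x \<in> span S"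
  shows "f x = h x"
  using assms(4)
  by (induction rule: span_induct_alt)
    (use assms in \<open>auto simp: lin_form_0 lin_form_add lin_form_scale\<close>)

lemma lin_form_zero: "lin_form scale (\<lambda>x. 0)"
  by (simp add: lin_form_def)

lemma lin_form_vanishes_on_span:
  assumes "lin_form scale f" "\<And>x. x \<in> S \<Longrightarrow> f x = 0" "x \<in> span S"
  shows "f x = 0"
  using lin_form_eq_on_span[OF assms(1) lin_form_zero assms(2) assms(3)] by simp

lemma lin_form_extend:
  assumes "independent B"
  obtains f where "lin_form scale f" "\<And>b. b \<in> B \<Longrightarrow> f b = t b"
proof -
  interpret K: vector_space "(*) :: 'a \<Rightarrow> 'a \<Rightarrow> 'a"
    by unfold_locales (simp_all add: algebra_simps)
  interpret vector_space_pair scale "(*) :: 'a \<Rightarrow> 'a \<Rightarrow> 'a"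
    by unfold_locales
  from linear_independent_extend[OF assms, of t] obtain f where
    f: "Vector_Spaces.linear scale (*) f" "\<forall>b\<in>B. f b = t b" by blast
  from f(1) interpret Vector_Spaces.linear scale "(*)" f .
  have "lin_form scale f" by (simp add: lin_form_def add scale)
  with f(2) that show ?thesis by blast
qed

lemma lin_form_separate:
  assumes "x \<notin> span S"
  obtains f where "lin_form scale f" "\<And>y. y \<in> span S \<Longrightarrow> f y = 0" "f x = 1"
proof -
  obtain B where B: "B \<subseteq> S" "independent B" "S \<subseteq> span B"
    using maximal_independent_subset[of S] by blast
  then have span: "span B = span S" by (metis span_eq span_superset subset_trans)
  have "independent (insert x B)" using B assms span by (auto simp: independent_insert)
  from lin_form_extend[OF this, of "\<lambda>y. if y = x then 1 else 0"] obtain f where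
    f: "lin_form scale f" "\<And>b. b \<in> insert x B \<Longrightarrow> f b = (if b = x then 1 else 0)" by blast
  have "f y = 0" if "y \<in> span S" for y
  proof (rule lin_form_vanishes_on_span[OF f(1)])
    show "y \<in> span B" using that span by simp
    show "f z = 0" if "z \<in> B" for z
      using f(2)[of z] that B(1) assms span_base by auto
  qed
  with f that show ?thesis by auto
qed

end

subsection \<open>The coproduct as seen by bilinear forms\<close>

context hopf_algebra
begin

lemma tensor2_relationsI:
  "formal_sum [(x + x', y)] - formal_sum [(x, y), (x', y)] \<in> tensor2_relations scale"
  "formal_sum [(x, y + y')] - formal_sum [(x, y), (x, y')] \<in> tensor2_relations scale"
  "formal_sum [(scale c x, y)] - free_scale c (formal_sum [(x, y)]) \<in> tensor2_relations scale"
  "formal_sum [(x, scale c y)] - free_scale c (formal_sum [(x, y)]) \<in> tensor2_relations scale"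
  unfolding tensor2_relations_def by blast+

definition bilin_form :: "('a \<Rightarrow> 'a \<Rightarrow> 'k) \<Rightarrow> bool" where
  "bilin_form \<beta> \<longleftrightarrow> (\<forall>y. lin_form scale (\<lambda>x. \<beta> x y)) \<and> (\<forall>x. lin_form scale (\<beta> x))"

lemma bilin_form_prod: "lin_form scale f \<Longrightarrow> lin_form scale h \<Longrightarrow> bilin_form (\<lambda>x y. f x * h y)"
  by (auto simp: bilin_form_def lin_form_def algebra_simps)

lemma bilin_form_mult:
  "bilin_form \<beta> \<Longrightarrow> bilin_form (\<lambda>x y. \<beta> (c * x * d) (e * y * f))"
  by (auto simp: bilin_form_def lin_form_def distrib_left distrib_right mult_scale_left mult_scale_right)

lemma tensor2_eq_bilin_form:
  assumes "bilin_form \<beta>" "tensor2_eq scale xs ys"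
  shows "(\<Sum>(x, y)\<leftarrow>xs. \<beta> x y) = (\<Sum>(x, y)\<leftarrow>ys. \<beta> x y)"
proof -
  \<comment> \<open>\<open>tensor2_eq_bilinear\<close> concerns maps into \<open>'a\<close>, so the
    values of the form are placed on the line through 1.\<close>
  have "(\<Sum>(x, y)\<leftarrow>xs. scale (\<beta> x y) 1) = (\<Sum>(x, y)\<leftarrow>ys. scale (\<beta> x y) 1)"
    by (rule tensor2_eq_bilinear[OF vector_space_axioms _ _ _ _ assms(2)])
      (use assms(1) in \<open>auto simp: bilin_form_def lin_form_def algebra_simps\<close>)
  moreover have "(\<Sum>(x, y)\<leftarrow>zs. scale (\<beta> x y) 1) = scale (\<Sum>(x, y)\<leftarrow>zs. \<beta> x y) 1" for zs
    by (induction zs) (auto simp: algebra_simps)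
  ultimately show ?thesis by (simp add: scale_right_imp_eq[OF one_neq_zero])
qed

text \<open>Bilinear forms separate tensors: a linear form on the free vector space that kills the
  relations but not the given difference is bilinear in the pairs. From here on, coproducts are only
  seen through such forms, whichever list \<open>comult\<close> chooses.\<close>

lemma tensor2_eq_iff:
  "tensor2_eq scale xs ys \<longleftrightarrow>
     (\<forall>\<beta>. bilin_form \<beta> \<longrightarrow> (\<Sum>(x, y)\<leftarrow>xs. \<beta> x y) = (\<Sum>(x, y)\<leftarrow>ys. \<beta> x y))"
proof (intro iffI allI impI)
  assume *: "\<forall>\<beta>. bilin_form \<beta> \<longrightarrow> (\<Sum>(x, y)\<leftarrow>xs. \<beta> x y) = (\<Sum>(x, y)\<leftarrow>ys. \<beta> x y)"
  interpret F: vector_space "free_scale :: 'k \<Rightarrow> ('a \<times> 'a \<Rightarrow>\<^sub>0 'k) \<Rightarrow> _"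
    by (rule vector_space_free_scale)
  show "tensor2_eq scale xs ys"
    unfolding tensor2_eq_def
  proof (rule ccontr)
    assume "formal_sum xs - formal_sum ys \<notin> F.span (tensor2_relations scale)"
    from F.lin_form_separate[OF this] obtain f where f: "lin_form free_scale f"
      "\<And>r. r \<in> F.span (tensor2_relations scale) \<Longrightarrow> f r = 0"
      "f (formal_sum xs - formal_sum ys) = 1" by metis
    define \<beta> where "\<beta> x y = f (formal_sum [(x, y)])" for x y
    have rel: "f r = 0" if "r \<in> tensor2_relations scale" for r
      using f(2) F.span_base that by blast
    have sum: "f (formal_sum zs) = (\<Sum>(x, y)\<leftarrow>zs. \<beta> x y)" for zs
      by (induction zs) (auto simp: \<beta>_def formal_sum_def lin_form_0[OF f(1)] lin_form_add[OF f(1)])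
    have "\<beta> (x + x') y = \<beta> x y + \<beta> x' y" for x x' y
      using rel[OF tensor2_relationsI(1)]
      by (simp add: lin_form_diff[OF f(1)] sum)
    moreover have "\<beta> x (y + y') = \<beta> x y + \<beta> x y'" for x y y'
      using rel[OF tensor2_relationsI(2)]
      by (simp add: lin_form_diff[OF f(1)] sum)
    moreover have "\<beta> (scale c x) y = c * \<beta> x y" for c x y
      using rel[OF tensor2_relationsI(3)]
      by (simp add: lin_form_diff[OF f(1)] lin_form_scale[OF f(1)] sum)
    moreover have "\<beta> x (scale c y) = c * \<beta> x y" for c x y
      using rel[OF tensor2_relationsI(4)]
      by (simp add: lin_form_diff[OF f(1)] lin_form_scale[OF f(1)] sum)
    ultimately have "bilin_form \<beta>" by (simp add: bilin_form_def lin_form_def)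
    with * f(3) show False by (simp add: lin_form_diff[OF f(1)] sum)
  qed
qed (rule tensor2_eq_bilin_form)

definition coprod_form :: "('a \<Rightarrow> 'a \<Rightarrow> 'k) \<Rightarrow> 'a \<Rightarrow> 'k" where
  "coprod_form \<beta> z = (\<Sum>(x, y)\<leftarrow>comult z. \<beta> x y)"

lemma lin_form_coprod_form:
  assumes "bilin_form \<beta>"
  shows "lin_form scale (coprod_form \<beta>)"
proof -
  have "coprod_form \<beta> (x + y) = coprod_form \<beta> x + coprod_form \<beta> y" for x y
    using tensor2_eq_bilin_form[OF assms comult_add] by (simp add: coprod_form_def)
  moreover have "coprod_form \<beta> (scale c x) = c * coprod_form \<beta> x" for c x
  proof -
    have "(\<Sum>(x, y)\<leftarrow>[(scale c x, y). (x, y) \<leftarrow> zs]. \<beta> x y) = c * (\<Sum>(x, y)\<leftarrow>zs. \<beta> x y)" for zs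
      using assms by (induction zs) (auto simp: bilin_form_def lin_form_def algebra_simps)
    with tensor2_eq_bilin_form[OF assms comult_scale[of c x]] show ?thesis
      by (simp add: coprod_form_def)
  qed
  ultimately show ?thesis by (simp add: lin_form_def)
qed

lemma bilin_form_coprod_form:
  assumes "bilin_form \<beta>"
  shows "bilin_form (\<lambda>x1 x2. coprod_form (\<lambda>y1 y2. \<beta> (x1 * y1) (x2 * y2)) z)"
proof -
  have "bilin_form (\<lambda>x1 x2. \<Sum>(y1, y2)\<leftarrow>zs. \<beta> (x1 * y1) (x2 * y2))" for zs
    using assms
    by (induction zs)
      (auto simp: bilin_form_def lin_form_def algebra_simps mult_scale_left mult_scale_right)
  then show ?thesis by (simp add: coprod_form_def)
qed

lemma coprod_form_mult:
  assumes "bilin_form \<beta>"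
  shows "coprod_form \<beta> (x * z) =
    coprod_form (\<lambda>x1 x2. coprod_form (\<lambda>y1 y2. \<beta> (x1 * y1) (x2 * y2)) z) x"
proof -
  have "(\<Sum>(x, y)\<leftarrow>[(x1 * y1, x2 * y2). (x1, x2) \<leftarrow> xs, (y1, y2) \<leftarrow> zs]. \<beta> x y) =
      (\<Sum>(x1, x2)\<leftarrow>xs. \<Sum>(y1, y2)\<leftarrow>zs. \<beta> (x1 * y1) (x2 * y2))" for xs zs
  proof (induction xs)
    case (Cons x xs)
    have "(\<Sum>(x, y)\<leftarrow>[(fst x * y1, snd x * y2). (y1, y2) \<leftarrow> zs]. \<beta> x y) =
      (\<Sum>(y1, y2)\<leftarrow>zs. \<beta> (fst x * y1) (snd x * y2))"
      by (induction zs) auto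
    with Cons show ?case by (simp add: case_prod_beta')
  qed simp
  with tensor2_eq_bilin_form[OF assms comult_mult[of x z]] show ?thesis
    by (simp add: coprod_form_def)
qed

section \<open>The group of group-like elements and its linear independence\<close>

lemma grouplikes_iff:
  "g \<in> grouplikes \<longleftrightarrow> (\<forall>\<beta>. bilin_form \<beta> \<longrightarrow> coprod_form \<beta> g = \<beta> g g) \<and> counit g = 1"
  by (simp add: grouplikes_def tensor2_eq_iff coprod_form_def)

lemma coprod_form_grouplike:
  "g \<in> grouplikes \<Longrightarrow> bilin_form \<beta> \<Longrightarrow> coprod_form \<beta> g = \<beta> g g"
  by (simp add: grouplikes_iff)

lemma coprod_form_grouplike_mult:
  assumes "g \<in> grouplikes" "bilin_form \<beta>"
  shows "coprod_form \<beta> (g * z) = coprod_form (\<lambda>x y. \<beta> (g * x) (g * y)) z"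
  using assms coprod_form_mult bilin_form_coprod_form coprod_form_grouplike by simp

lemma one_grouplike: "1 \<in> grouplikes"
  using comult_one counit_one by (simp add: grouplikes_def)

lemma bilin_form_mult_left: "bilin_form \<beta> \<Longrightarrow> bilin_form (\<lambda>x y. \<beta> (c * x) (e * y))"
  using bilin_form_mult[of \<beta> c 1 e 1] by simp

lemma mult_grouplike:
  assumes "g \<in> grouplikes" "g' \<in> grouplikes"
  shows "g * g' \<in> grouplikes"
  using assms
  by (auto simp: grouplikes_iff[of "g * g'"] coprod_form_grouplike_mult coprod_form_grouplike
      bilin_form_mult_left counit_mult) (auto simp: grouplikes_iff)

lemma antipode_grouplike:
  assumes g: "g \<in> grouplikes"
  shows "antipode g \<in> grouplikes"
  unfolding grouplikes_iff
proof (intro conjI allI impI)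
  fix \<beta> assume \<beta>: "bilin_form \<beta>"
  \<comment> \<open>After this translation the value on \<open>g * antipode g\<close> is that of
    \<open>\<beta>\<close> on the coproduct of \<open>antipode g\<close>, while
    \<open>g * antipode g = 1\<close> evaluates it directly.\<close>
  define \<gamma> where "\<gamma> = (\<lambda>x y. \<beta> (antipode g * x) (antipode g * y))"
  have \<gamma>: "bilin_form \<gamma>" unfolding \<gamma>_def by (rule bilin_form_mult_left[OF \<beta>])
  have "coprod_form \<gamma> (g * antipode g) = coprod_form \<beta> (antipode g)"
    unfolding coprod_form_grouplike_mult[OF g \<gamma>]
    by (simp add: \<gamma>_def grouplike_inverse[OF g] flip: mult.assoc)
  moreover have "coprod_form \<gamma> (g * antipode g) = \<beta> (antipode g) (antipode g)"
    using coprod_form_grouplike[OF one_grouplike \<gamma>] by (simp add: grouplike_inverse[OF g] \<gamma>_def)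
  ultimately show "coprod_form \<beta> (antipode g) = \<beta> (antipode g) (antipode g)" by simp
next
  have "counit (g * antipode g) = 1" by (simp add: grouplike_inverse[OF g] counit_one)
  with g show "counit (antipode g) = 1" by (simp add: counit_mult grouplikes_iff)
qed

lemma lin_form_counit: "lin_form scale counit"
  by (simp add: lin_form_def counit_add counit_scale)

lemma eq_if_lin_form_eq:
  assumes "\<And>f. lin_form scale f \<Longrightarrow> f x = f y"
  shows "x = y"
proof (rule ccontr)
  assume "x \<noteq> y"
  then have "x - y \<notin> span {}" by simp
  from lin_form_separate[OF this] obtain f where "lin_form scale f" "f (x - y) = 1" by metis
  with assms[of f] show False by (simp add: lin_form_diff)
qed

text \<open>Let g be a combination of the elements t of \<open>T\<close> with coefficients c_t.
  Pairing the coproduct with the coordinate form of t and an arbitrary \<psi> gives c_t \<psi>(g) =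
  c_t \<psi>(t), so c_t = 0 unless g = t. As g is not in \<open>T\<close>, all c_t vanish,
  contradicting \<open>counit g = 1\<close>.\<close>

lemma independent_grouplikes: "independent grouplikes"
proof -
  have "independent T" if "finite T" "T \<subseteq> grouplikes" for T
    using that
  proof (induction rule: finite_induct)
    case (insert g T)
    have T: "independent T" by (rule insert.IH) (use insert.prems in blast)
    have g: "g \<in> grouplikes" using insert.prems by blast
    have "g \<notin> span T"
    proof
      assume span: "g \<in> span T"
      have "\<exists>f. lin_form scale f \<and> (\<forall>s\<in>T. f s = (if s = t then 1 else 0))" for t
        by (rule lin_form_extend[OF T, of "\<lambda>s. if s = t then 1 else 0"]) blast
      then obtain f where f: "\<And>t. lin_form scale (f t)"
        "\<And>t s. s \<in> T \<Longrightarrow> f t s = (if s = t then 1 else 0)" by metis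
      have "f t g = 0" if t: "t \<in> T" for t
      proof (rule ccontr)
        assume nz: "f t g \<noteq> 0"
        have "\<psi> g = \<psi> t" if \<psi>: "lin_form scale \<psi>" for \<psi>
        proof -
          have b: "bilin_form (\<lambda>x y. f t x * \<psi> y)" by (rule bilin_form_prod[OF f(1) \<psi>])
          have "coprod_form (\<lambda>x y. f t x * \<psi> y) g = \<psi> t * f t g"
          proof (rule lin_form_eq_on_span[OF lin_form_coprod_form[OF b] _ _ span])
            show "lin_form scale (\<lambda>x. \<psi> t * f t x)"
              using f(1)[of t] by (simp add: lin_form_def algebra_simps)
            show "coprod_form (\<lambda>x y. f t x * \<psi> y) s = \<psi> t * f t s" if "s \<in> T" for s
              using coprod_form_grouplike[OF _ b, of s] insert.prems that f(2)[of s t] by auto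
          qed
          with coprod_form_grouplike[OF g b] nz show ?thesis by simp
        qed
        then have "g = t" by (rule eq_if_lin_form_eq)
        with t insert.hyps show False by simp
      qed
      moreover have "counit g = (\<Sum>t\<in>T. counit t * f t g)"
      proof (rule lin_form_eq_on_span[OF lin_form_counit _ _ span])
        show "lin_form scale (\<lambda>x. \<Sum>t\<in>T. counit t * f t x)"
          using f(1) by (simp add: lin_form_def algebra_simps sum.distrib sum_distrib_left)
        show "counit s = (\<Sum>t\<in>T. counit t * f t s)" if "s \<in> T" for s
        proof -
          have "(\<Sum>t\<in>T. counit t * f t s) = (\<Sum>t\<in>T. if s = t then counit t else 0)"
            by (intro sum.cong) (use f(2)[OF that] in auto)
          with insert.hyps(1) that show ?thesis by simp
        qed
      qed
      ultimately show False using g by (simp add: grouplikes_iff)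
    qed
    with T insert.hyps show ?case by (simp add: independent_insert)
  qed (rule independent_empty)
  then show ?thesis
    unfolding independent_explicit_finite_subsets by blast
qed

end

subsection \<open>Weighted sums over unshuffles\<close>

text \<open>For \<open>P i j = chi i (ga j)\<close> this is the scalar p_uv of the words
  \<open>u\<close> and \<open>v\<close>.\<close>

definition wpair :: "('i \<Rightarrow> 'i \<Rightarrow> 'k::comm_ring_1) \<Rightarrow> 'i list \<Rightarrow> 'i list \<Rightarrow> 'k" where
  "wpair P u v = (\<Prod>i\<leftarrow>u. \<Prod>j\<leftarrow>v. P i j)"

lemma wpair_Nil [simp]: "wpair P [] v = 1" "wpair P u [] = 1"
  by (simp add: wpair_def) (induction u; simp add: wpair_def)

lemma wpair_append_left: "wpair P (u @ u') v = wpair P u v * wpair P u' v"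
  by (simp add: wpair_def)

lemma wpair_Cons: "wpair P (i # u) v = wpair P [i] v * wpair P u v"
  using wpair_append_left[of P "[i]" u v] by simp

lemma wpair_append_right: "wpair P u (v @ v') = wpair P u v * wpair P u v'"
  by (induction u) (simp_all add: wpair_def algebra_simps)

lemma wpair_wpow_left: "wpair P (wpow u k) v = wpair P u v ^ k"
  by (induction k) (simp_all add: wpair_append_left)

lemma wpair_wpow_right: "wpair P u (wpow v k) = wpair P u v ^ k"
  by (induction k) (simp_all add: wpair_append_right)

text \<open>The sum over all ways to distribute the letters of \<open>w\<close> to a left word
  \<open>u\<close> and a right word \<open>v\<close>. The weight is the product of
  \<open>P i j\<close> over left letters \<open>i\<close> and right letters \<open>j\<close> that
  come later in \<open>w\<close>: the price of moving a_i past the group-like that j leaves in the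
  left tensor factor.\<close>

primrec usum :: "('i \<Rightarrow> 'i \<Rightarrow> 'k::comm_ring_1) \<Rightarrow> 'i list \<Rightarrow> ('i list \<Rightarrow> 'i list \<Rightarrow> 'k) \<Rightarrow> 'k" where
  "usum P [] F = F [] []"
| "usum P (i # w) F = usum P w (\<lambda>u v. wpair P [i] v * F (i # u) v) + usum P w (\<lambda>u v. F u (i # v))"

lemma usum_cong:
  assumes "\<And>u v. w \<in> shuffles u v \<Longrightarrow> F u v = F' u v"
  shows "usum P w F = usum P w F'"
  using assms
proof (induction w arbitrary: F F')
  case (Cons i w)
  have "usum P w (\<lambda>u v. wpair P [i] v * F (i # u) v) = usum P w (\<lambda>u v. wpair P [i] v * F' (i # u) v)"
    by (rule Cons.IH) (simp add: Cons.prems Cons_in_shuffles_leftI)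
  moreover have "usum P w (\<lambda>u v. F u (i # v)) = usum P w (\<lambda>u v. F' u (i # v))"
    by (rule Cons.IH) (simp add: Cons.prems Cons_in_shuffles_rightI)
  ultimately show ?case by simp
qed simp

lemma usum_zero [simp]: "usum P w (\<lambda>u v. 0) = 0"
  by (induction w) auto

lemma usum_eq_0: "(\<And>u v. w \<in> shuffles u v \<Longrightarrow> F u v = 0) \<Longrightarrow> usum P w F = 0"
  using usum_cong[of w F "\<lambda>u v. 0"] by simp

lemma usum_cmult: "usum P w (\<lambda>u v. c * F u v) = c * usum P w F"
proof (induction w arbitrary: F)
  case (Cons i w)
  show ?case
    using Cons.IH[of "\<lambda>u v. wpair P [i] v * F (i # u) v"] Cons.IH[of "\<lambda>u v. F u (i # v)"]
    by (simp add: algebra_simps)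
qed simp

text \<open>The extra factor \<open>wpair P u v'\<close> accounts for the pairs of letters on
  different sides of the cut.\<close>

lemma usum_append:
  "usum P (w @ w') F =
     usum P w (\<lambda>u v. usum P w' (\<lambda>u' v'. wpair P u v' * F (u @ u') (v @ v')))"
proof (induction w arbitrary: F)
  case (Cons i w)
  have "usum P w' (\<lambda>u' v'. wpair P u v' * (wpair P [i] (v @ v') * F (i # u @ u') (v @ v'))) =
      wpair P [i] v * usum P w' (\<lambda>u' v'. wpair P (i # u) v' * F ((i # u) @ u') (v @ v'))" for u v
    unfolding usum_cmult[symmetric]
    by (rule usum_cong) (simp add: wpair_Cons[of P i u] wpair_append_right mult_ac)
  then show ?case by (simp add: Cons.IH)
qed simp

lemma usum_Nil_right:
  assumes "\<And>u v. w \<in> shuffles u v \<Longrightarrow> v \<noteq> [] \<Longrightarrow> F u v = 0"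
  shows "usum P w F = F w []"
  using assms
proof (induction w arbitrary: F)
  case (Cons i w)
  have "usum P w (\<lambda>u v. wpair P [i] v * F (i # u) v) = wpair P [i] [] * F (i # w) []"
    by (rule Cons.IH) (simp add: Cons.prems Cons_in_shuffles_leftI)
  moreover have "usum P w (\<lambda>u v. F u (i # v)) = 0"
    by (rule usum_eq_0) (simp add: Cons.prems Cons_in_shuffles_rightI)
  ultimately show ?case by simp
qed simp

lemma usum_Nil_left:
  assumes "\<And>u v. w \<in> shuffles u v \<Longrightarrow> u \<noteq> [] \<Longrightarrow> F u v = 0"
  shows "usum P w F = F [] w"
  using assms
proof (induction w arbitrary: F)
  case (Cons i w)
  have "usum P w (\<lambda>u v. wpair P [i] v * F (i # u) v) = 0"
    by (rule usum_eq_0) (simp add: Cons.prems Cons_in_shuffles_leftI)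
  moreover have "usum P w (\<lambda>u v. F u (i # v)) = F [] (i # w)"
    by (rule Cons.IH) (simp add: Cons.prems Cons_in_shuffles_rightI)
  ultimately show ?case by simp
qed simp

lemma usum_ends:
  assumes "w \<noteq> []" "\<And>u v. w \<in> shuffles u v \<Longrightarrow> u \<noteq> [] \<Longrightarrow> v \<noteq> [] \<Longrightarrow> F u v = 0"
  shows "usum P w F = F w [] + F [] w"
proof -
  obtain i w' where w: "w = i # w'" using assms(1) by (cases w) auto
  have "usum P w' (\<lambda>u v. wpair P [i] v * F (i # u) v) = wpair P [i] [] * F (i # w') []"
    by (rule usum_Nil_right) (simp add: assms(2) w Cons_in_shuffles_leftI)
  moreover have "usum P w' (\<lambda>u v. F u (i # v)) = F [] (i # w')"
    by (rule usum_Nil_left) (simp add: assms(2) w Cons_in_shuffles_rightI)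
  ultimately show ?thesis using w by simp
qed

definition wdelta :: "'i list \<Rightarrow> 'i list \<Rightarrow> 'i list \<Rightarrow> 'i list \<Rightarrow> 'k::comm_ring_1" where
  "wdelta x y u v = (if u = x \<and> v = y then 1 else 0)"

text \<open>Only one distribution contributes. By \<open>lyndon_shuffle_prefix\<close> the first
  block \<open>l\<close> cannot be divided between the two words, and it cannot go right as a whole
  because \<open>v < l\<close> excludes \<open>l\<close> as a prefix of \<open>v\<close>. So each
  block goes left and passes \<open>v\<close> once.\<close>

lemma usum_wpow_append:
  fixes l v :: "'i::linorder list" and P :: "'i \<Rightarrow> 'i \<Rightarrow> 'k::comm_ring_1"
  assumes l: "lyndon l" and v: "v < l"
  shows "usum P (wpow l k @ v) (wdelta (wpow l k) v) = wpair P l v ^ k"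
proof (induction k)
  case 0
  show ?case
    by (subst usum_Nil_left) (auto simp: wdelta_def)
next
  case (Suc k)
  define F where "F = (\<lambda>u1 v1. usum P (wpow l k @ v)
      (\<lambda>u2 v2. wpair P u1 v2 * wdelta (wpow l (Suc k)) v (u1 @ u2) (v1 @ v2)))"
  have "usum P l F = F l [] + F [] l"
  proof (rule usum_ends)
    show "l \<noteq> []" by (rule lyndon_not_Nil[OF l])
    fix u1 v1 assume *: "l \<in> shuffles u1 v1" "u1 \<noteq> []" "v1 \<noteq> []"
    have no: False if "u1 @ u2 = wpow l (Suc k)" "v1 @ v2 = v" for u2 v2
    proof -
      have "length u1 \<le> length l" using length_shuffles[OF *(1)] by simp
      with wpow_prefix[OF that(1)[symmetric]] obtain s where "l = u1 @ s" by blast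
      moreover have "v1 \<le> l" using le_append[of v1 v2] that(2) v by auto
      ultimately show False using lyndon_shuffle_prefix(2)[OF l _ *(1)] * by auto
    qed
    have "wdelta (wpow l (Suc k)) v (u1 @ u2) (v1 @ v2) = (0 :: 'k)" for u2 v2
      unfolding wdelta_def by (rule if_not_P) (use no in blast)
    then show "F u1 v1 = 0" by (simp add: F_def)
  qed
  moreover have "F [] l = 0"
  proof -
    have no: "l @ v2 \<noteq> v" for v2 using le_append[of l v2] v by auto
    have "wdelta (wpow l (Suc k)) v ([] @ u2) (l @ v2) = (0 :: 'k)" for u2 v2
      unfolding wdelta_def by (rule if_not_P) (use no in blast)
    then show ?thesis by (simp add: F_def)
  qed
  moreover have "F l [] = wpair P l v * usum P (wpow l k @ v) (wdelta (wpow l k) v)"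
    unfolding F_def usum_cmult[symmetric] by (intro usum_cong) (auto simp: wdelta_def)
  moreover have "usum P (wpow l (Suc k) @ v) (wdelta (wpow l (Suc k)) v) = usum P l F"
    by (simp add: usum_append F_def)
  ultimately show ?case using Suc by simp
qed

text \<open>The first block \<open>l\<close> goes undivided to one side: to the left past the
  \<open>Suc j\<close> blocks on the right, or to the right at no cost. These two cases are the
  recursion of \<open>gbin\<close>.\<close>

lemma usum_wpow_wpow:
  fixes l :: "'i::linorder list" and P :: "'i \<Rightarrow> 'i \<Rightarrow> 'k::field"
  assumes l: "lyndon l"
  shows "usum P (wpow l (i + j)) (wdelta (wpow l i) (wpow l j)) = gbin (wpair P l l) i j"
proof (induction "wpair P l l" i j rule: gbin.induct)
  case (1 j)
  show ?case by (simp, subst usum_Nil_left) (auto simp: wdelta_def)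
next
  case (2 i)
  show ?case by (simp add: del: wpow_Suc, subst usum_Nil_right) (auto simp: wdelta_def)
next
  case (3 i j)
  define w where "w = wpow l (i + Suc j)"
  define F where "F = (\<lambda>u1 v1. usum P w
      (\<lambda>u2 v2. wpair P u1 v2 * wdelta (wpow l (Suc i)) (wpow l (Suc j)) (u1 @ u2) (v1 @ v2)))"
  have "usum P l F = F l [] + F [] l"
  proof (rule usum_ends)
    show "l \<noteq> []" by (rule lyndon_not_Nil[OF l])
    fix u1 v1 assume *: "l \<in> shuffles u1 v1" "u1 \<noteq> []" "v1 \<noteq> []"
    have no: False if eq: "u1 @ u2 = wpow l (Suc i)" "v1 @ v2 = wpow l (Suc j)" for u2 v2
    proof -
      have len: "length u1 \<le> length l" "length v1 \<le> length l" using length_shuffles[OF *(1)] by auto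
      obtain s where s: "l = u1 @ s" using wpow_prefix[OF eq(1)[symmetric] len(1)] by blast
      obtain t where t: "l = v1 @ t" using wpow_prefix[OF eq(2)[symmetric] len(2)] by blast
      have "v1 \<le> l" using le_append[of v1 t] t by simp
      with lyndon_shuffle_prefix(2)[OF l s *(1)] * show False by auto
    qed
    have "wdelta (wpow l (Suc i)) (wpow l (Suc j)) (u1 @ u2) (v1 @ v2) = (0 :: 'k)" for u2 v2
      unfolding wdelta_def by (rule if_not_P) (use no in blast)
    then show "F u1 v1 = 0" by (simp add: F_def)
  qed
  moreover have "F l [] = wpair P l l ^ Suc j * usum P w (wdelta (wpow l i) (wpow l (Suc j)))"
    unfolding F_def usum_cmult[symmetric] wpair_wpow_right[symmetric]
    by (intro usum_cong) (auto simp: wdelta_def)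
  moreover have "F [] l = usum P w (wdelta (wpow l (Suc i)) (wpow l j))"
    unfolding F_def by (intro usum_cong) (auto simp: wdelta_def)
  moreover have "usum P (wpow l (Suc i + Suc j)) (wdelta (wpow l (Suc i)) (wpow l (Suc j))) = usum P l F"
    by (simp add: usum_append F_def w_def)
  moreover have "w = wpow l (Suc i + j)" by (simp add: w_def)
  ultimately show ?case using 3 by (simp add: w_def)
qed

subsection \<open>Normal words\<close>

context character_hopf_algebra
begin

section \<open>Values of words in H and their coproducts\<close>

definition wval :: "nat list \<Rightarrow> 'a" where "wval w = prod_list (map a w)"
definition wgrp :: "nat list \<Rightarrow> 'a" where "wgrp w = prod_list (map ga w)"
definition wchi :: "nat list \<Rightarrow> 'a \<Rightarrow> 'k" where "wchi w g = (\<Prod>i\<leftarrow>w. chi i g)"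
definition alphabet_words :: "nat list set" where "alphabet_words = {w. set w \<subseteq> {..<n}}"

abbreviation chi_pair :: "nat list \<Rightarrow> nat list \<Rightarrow> 'k" where
  "chi_pair \<equiv> wpair (\<lambda>i j. chi i (ga j))"

lemma wval_simps [simp]: "wval [] = 1" "wval (i # w) = a i * wval w" "wval (u @ v) = wval u * wval v"
  and wgrp_simps [simp]: "wgrp [] = 1" "wgrp (i # w) = ga i * wgrp w"
  by (simp_all add: wval_def wgrp_def)

lemma wval_wpow: "wval (wpow w k) = wval w ^ k"
  by (induction k) simp_all

lemma alphabet_words_simps [simp]:
  "[] \<in> alphabet_words" "i # w \<in> alphabet_words \<longleftrightarrow> i < n \<and> w \<in> alphabet_words"
  "u @ v \<in> alphabet_words \<longleftrightarrow> u \<in> alphabet_words \<and> v \<in> alphabet_words"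
  by (auto simp: alphabet_words_def)

lemma shuffles_alphabet_words:
  "w \<in> shuffles u v \<Longrightarrow> w \<in> alphabet_words \<longleftrightarrow> u \<in> alphabet_words \<and> v \<in> alphabet_words"
  by (auto simp: alphabet_words_def set_shuffles)

lemma wgrp_grouplike: "w \<in> alphabet_words \<Longrightarrow> wgrp w \<in> grouplikes"
  by (induction w) (auto simp: one_grouplike mult_grouplike ga_grouplike)

lemma chi_one: "i < n \<Longrightarrow> chi i 1 = 1"
  using chi_mult[of i 1 1] chi_nonzero[of i 1] one_grouplike by simp

lemma chi_wgrp: "i < n \<Longrightarrow> w \<in> alphabet_words \<Longrightarrow> chi i (wgrp w) = chi_pair [i] w"
  by (induction w) (auto simp: chi_one chi_mult ga_grouplike wgrp_grouplike wpair_def)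

lemma chi_pair_nonzero: "u \<in> alphabet_words \<Longrightarrow> v \<in> alphabet_words \<Longrightarrow> chi_pair u v \<noteq> 0"
  using chi_nonzero[OF _ ga_grouplike]
  by (auto simp: wpair_def alphabet_words_def prod_list_zero_iff subset_iff)

lemma a_commute:
  assumes "i < n" "g \<in> grouplikes"
  shows "a i * g = scale (chi i g) (g * a i)"
proof -
  have "a i * g = g * (antipode g * a i * g)"
    by (simp add: grouplike_inverse[OF assms(2)] flip: mult.assoc)
  then show ?thesis using semi_invariant[OF assms] by (simp add: mult_scale_right)
qed

lemma wval_commute:
  "w \<in> alphabet_words \<Longrightarrow> g \<in> grouplikes \<Longrightarrow> wval w * g = scale (wchi w g) (g * wval w)"
proof (induction w)
  case (Cons i w)
  have "wval (i # w) * g = scale (wchi w g) (a i * g * wval w)"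
    using Cons by (simp add: mult.assoc mult_scale_right)
  also have "\<dots> = scale (wchi (i # w) g) (g * wval (i # w))"
    using a_commute Cons by (simp add: wchi_def mult_scale_left mult.assoc mult.commute)
  finally show ?case .
qed (simp add: wchi_def)

text \<open>Multiplying out the coproducts of the letters, each letter goes left, or goes right and
  leaves its group-like on the left. Collecting the group-likes in front of the left word produces
  the weights of \<open>usum\<close>.\<close>

lemma coprod_form_wval:
  "w \<in> alphabet_words \<Longrightarrow> bilin_form \<beta> \<Longrightarrow>
     coprod_form \<beta> (wval w) = usum (\<lambda>i j. chi i (ga j)) w (\<lambda>u v. \<beta> (wgrp v * wval u) (wval v))"
proof (induction w arbitrary: \<beta>)
  case Nil
  then show ?case using coprod_form_grouplike[OF one_grouplike] by simp
next
  case (Cons i w)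
  then have i: "i < n" and w: "w \<in> alphabet_words" by auto
  note \<beta> = \<open>bilin_form \<beta>\<close>
  let ?\<gamma> = "\<lambda>x1 x2. coprod_form (\<lambda>y1 y2. \<beta> (x1 * y1) (x2 * y2)) (wval w)"
  have "coprod_form \<beta> (wval (i # w)) = coprod_form ?\<gamma> (a i)"
    by (simp add: coprod_form_mult[OF \<beta>])
  also have "\<dots> = ?\<gamma> (a i) 1 + ?\<gamma> (ga i) (a i)"
    using tensor2_eq_bilin_form[OF bilin_form_coprod_form[OF \<beta>] skew_primitive[OF i]]
    unfolding coprod_form_def by simp
  also have "?\<gamma> (a i) 1 = usum (\<lambda>i j. chi i (ga j)) w
      (\<lambda>u v. chi_pair [i] v * \<beta> (wgrp v * wval (i # u)) (wval v))"
    unfolding Cons.IH[OF w bilin_form_mult_left[OF \<beta>]]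
  proof (rule usum_cong)
    fix u v assume "w \<in> shuffles u v"
    with w have v: "v \<in> alphabet_words" using shuffles_alphabet_words by blast
    have "a i * (wgrp v * wval u) = scale (chi_pair [i] v) (wgrp v * wval (i # u))"
      using a_commute[OF i wgrp_grouplike[OF v]] chi_wgrp[OF i v]
      by (simp add: mult_scale_left flip: mult.assoc)
    then show "\<beta> (a i * (wgrp v * wval u)) (1 * wval v) =
        chi_pair [i] v * \<beta> (wgrp v * wval (i # u)) (wval v)"
      using \<beta> by (simp add: bilin_form_def lin_form_def)
  qed
  also have "?\<gamma> (ga i) (a i) = usum (\<lambda>i j. chi i (ga j)) w
      (\<lambda>u v. \<beta> (wgrp (i # v) * wval u) (wval (i # v)))"
    unfolding Cons.IH[OF w bilin_form_mult_left[OF \<beta>]] by (simp add: mult.assoc)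
  finally show ?case by simp
qed

lemma coprod_form_grouplike_wval:
  assumes "g \<in> grouplikes" "w \<in> alphabet_words" "bilin_form \<beta>"
  shows "coprod_form \<beta> (g * wval w) =
    usum (\<lambda>i j. chi i (ga j)) w (\<lambda>u v. \<beta> (g * (wgrp v * wval u)) (g * wval v))"
  using assms coprod_form_grouplike_mult coprod_form_wval bilin_form_mult_left by simp

text \<open>
  Words of equal length are compared in the reverse of the lexicographic order: the products
  \<open>l\<^sub>1 \<cdots> l\<^sub>m\<close> of interest are lexicographically maximal among the shuffles of their factors,
  so the words preceding them do not contribute to the relevant component of the coproduct.
\<close>

definition prec :: "nat list \<Rightarrow> nat list \<Rightarrow> bool" where
  "prec u v \<longleftrightarrow> length u < length v \<or> length u = length v \<and> v < u"

lemma prec_irrefl: "\<not> prec w w"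
  and prec_trans: "prec u v \<Longrightarrow> prec v w \<Longrightarrow> prec u w"
  and prec_total: "u = v \<or> prec u v \<or> prec v u"
  by (auto simp: prec_def)

lemma prec_append: "prec u v \<Longrightarrow> prec (x @ u @ y) (x @ v @ y)"
  by (auto simp: prec_def append_less_append_iff)

text \<open>The finite alphabet is essential: for unrestricted letters \<open>[0]\<close>,
  \<open>[1]\<close>, \<open>[2]\<close> and so on would be an infinite descending chain. Over
  \<open>{..<n}\<close> only finitely many words precede a given one.\<close>

lemma prec_induct [consumes 1, case_names prec]:
  assumes "w \<in> alphabet_words"
    and step: "\<And>w. w \<in> alphabet_words \<Longrightarrow>
      (\<And>v. v \<in> alphabet_words \<Longrightarrow> prec v w \<Longrightarrow> Q v) \<Longrightarrow> Q w"
  shows "Q w"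
  using assms(1)
proof (induction "card {v \<in> alphabet_words. prec v w}" arbitrary: w rule: less_induct)
  case less
  have fin: "finite {v \<in> alphabet_words. prec v w}"
    by (rule finite_subset[OF _ finite_lists_length_le[of "{..<n}" "length w"]])
      (auto simp: alphabet_words_def prec_def)
  show ?case
  proof (rule step[OF less.prems])
    fix v assume v: "v \<in> alphabet_words" "prec v w"
    have "{u \<in> alphabet_words. prec u v} \<subset> {v \<in> alphabet_words. prec v w}"
      using v prec_trans prec_irrefl by blast
    with fin v show "Q v" by (intro less.hyps psubset_card_mono)
  qed
qed

section \<open>Normal words and the basis they give\<close>

definition gwords :: "nat list set \<Rightarrow> 'a set" where
  "gwords W = {g * wval w | g w. g \<in> grouplikes \<and> w \<in> W}"

definition below :: "nat list \<Rightarrow> 'a set" where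
  "below w = span (gwords {v \<in> alphabet_words. prec v w})"

definition normal :: "nat list \<Rightarrow> bool" where
  "normal w \<longleftrightarrow> w \<in> alphabet_words \<and> wval w \<notin> below w"

lemma gwordsI: "g \<in> grouplikes \<Longrightarrow> w \<in> W \<Longrightarrow> g * wval w \<in> gwords W"
  by (auto simp: gwords_def)

lemma gwords_mono: "W \<subseteq> W' \<Longrightarrow> gwords W \<subseteq> gwords W'"
  by (auto simp: gwords_def)

lemma in_below:
  "g \<in> grouplikes \<Longrightarrow> v \<in> alphabet_words \<Longrightarrow> prec v w \<Longrightarrow> g * wval v \<in> below w"
  unfolding below_def by (intro span_base gwordsI) auto

text \<open>\<open>prec\<close> survives concatenation on both sides, and a group-like passes a word
  at the cost of a scalar. Hence factors of normal words are normal.\<close>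

lemma below_sandwich:
  assumes u: "u \<in> alphabet_words" and v: "v \<in> alphabet_words" and g: "g \<in> grouplikes"
    and x: "x \<in> below w"
  shows "wval u * (g * x) * wval v \<in> below (u @ w @ v)"
  using x unfolding below_def[of w]
proof (induction rule: span_induct_alt)
  case base
  show ?case by (simp add: below_def span_zero)
next
  case (step c x y)
  then obtain h w' where x: "x = h * wval w'" "h \<in> grouplikes" "w' \<in> alphabet_words" "prec w' w"
    by (auto simp: gwords_def)
  have gh: "g * h \<in> grouplikes" using g x by (simp add: mult_grouplike)
  have "wval u * (g * x) * wval v = wval u * (g * h) * (wval w' * wval v)"
    using x by (simp add: mult.assoc)
  also have "\<dots> = scale (wchi u (g * h)) ((g * h) * wval (u @ w' @ v))"
    unfolding wval_commute[OF u gh] by (simp add: mult_scale_left mult.assoc)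
  finally have "wval u * (g * x) * wval v \<in> below (u @ w @ v)"
    using in_below[OF gh, of "u @ w' @ v" "u @ w @ v"] prec_append x u v
    by (simp add: below_def span_scale)
  then have "scale c (wval u * (g * x) * wval v) + wval u * (g * y) * wval v \<in> below (u @ w @ v)"
    using step.IH by (simp add: below_def span_add span_scale)
  then show ?case by (simp add: algebra_simps mult_scale_left mult_scale_right)
qed

lemma below_grouplike: "g \<in> grouplikes \<Longrightarrow> x \<in> below w \<Longrightarrow> g * x \<in> below w"
  using below_sandwich[of "[]" "[]" g x w] by simp

lemma normal_subword:
  assumes "normal (u @ w @ v)"
  shows "normal w"
proof -
  from assms have "u \<in> alphabet_words" "v \<in> alphabet_words" "w \<in> alphabet_words"
    by (auto simp: normal_def)
  moreover from this have "wval w \<notin> below w"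
    using below_sandwich[of u v 1 "wval w" w] assms one_grouplike
    by (auto simp: normal_def mult.assoc)
  ultimately show ?thesis by (simp add: normal_def)
qed

lemma normal_Nil: "normal []"
  by (simp add: normal_def below_def gwords_def prec_def)

lemma normal_grouplike:
  assumes "normal w" "g \<in> grouplikes"
  shows "g * wval w \<notin> below w"
proof
  assume "g * wval w \<in> below w"
  then have "antipode g * (g * wval w) \<in> below w"
    by (rule below_grouplike[OF antipode_grouplike[OF assms(2)]])
  with assms show False
    by (simp add: grouplike_inverse normal_def flip: mult.assoc)
qed

lemma span_normal_le:
  assumes "w \<in> alphabet_words" "g \<in> grouplikes"
  shows "g * wval w \<in> span (gwords {v. normal v \<and> (v = w \<or> prec v w)})"
  using assms
proof (induction arbitrary: g rule: prec_induct)
  case (prec w)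
  show ?case
  proof (cases "normal w")
    case True
    with prec.prems show ?thesis by (intro span_base gwordsI) auto
  next
    case False
    with prec have "g * wval w \<in> below w" by (simp add: normal_def below_grouplike)
    moreover have "gwords {v \<in> alphabet_words. prec v w} \<subseteq>
        span (gwords {v. normal v \<and> (v = w \<or> prec v w)})"
    proof
      fix x assume "x \<in> gwords {v \<in> alphabet_words. prec v w}"
      then obtain h v where x: "x = h * wval v" "h \<in> grouplikes" "v \<in> alphabet_words" "prec v w"
        by (auto simp: gwords_def)
      with prec.IH have "x \<in> span (gwords {u. normal u \<and> (u = v \<or> prec u v)})" by blast
      moreover have "gwords {u. normal u \<and> (u = v \<or> prec u v)} \<subseteq>
          gwords {v. normal v \<and> (v = w \<or> prec v w)}"
        using x(4) prec_trans by (intro gwords_mono) blast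
      ultimately show "x \<in> span (gwords {v. normal v \<and> (v = w \<or> prec v w)})"
        using span_mono by blast
    qed
    ultimately show ?thesis
      unfolding below_def using span_minimal subspace_span by blast
  qed
qed

lemma below_normal: "below w \<subseteq> span (gwords {v. normal v \<and> prec v w})"
  unfolding below_def
proof (rule span_minimal[OF _ subspace_span], rule subsetI)
  fix x assume "x \<in> gwords {v \<in> alphabet_words. prec v w}"
  then obtain h v where x: "x = h * wval v" "h \<in> grouplikes" "v \<in> alphabet_words" "prec v w"
    by (auto simp: gwords_def)
  then have "x \<in> span (gwords {u. normal u \<and> (u = v \<or> prec u v)})"
    using span_normal_le by blast
  moreover have "gwords {u. normal u \<and> (u = v \<or> prec u v)} \<subseteq> gwords {v. normal v \<and> prec v w}"
    using x(4) prec_trans by (intro gwords_mono) blast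
  ultimately show "x \<in> span (gwords {v. normal v \<and> prec v w})" using span_mono by blast
qed

lemma span_gwords: "span (gwords alphabet_words) = UNIV"
proof -
  let ?S = "span (gwords alphabet_words)"
  have gen: "x * y \<in> ?S" if "x \<in> gwords alphabet_words" "y \<in> gwords alphabet_words" for x y
  proof -
    from that obtain g u h v where x: "x = g * wval u" "g \<in> grouplikes" "u \<in> alphabet_words"
      and y: "y = h * wval v" "h \<in> grouplikes" "v \<in> alphabet_words" by (auto simp: gwords_def)
    have "x * y = g * (wval u * h) * wval v" using x y by (simp add: mult.assoc)
    also have "\<dots> = scale (wchi u h) ((g * h) * wval (u @ v))"
      using wval_commute[OF x(3) y(2)] by (simp add: mult_scale_left mult_scale_right mult.assoc)
    also have "\<dots> \<in> ?S"
      using x y by (intro span_scale span_base gwordsI mult_grouplike) auto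
    finally show ?thesis .
  qed
  have left: "x * y \<in> ?S" if "x \<in> gwords alphabet_words" "y \<in> ?S" for x y
    using that(2)
    by (induction rule: span_induct_alt)
      (use that(1) gen in \<open>auto simp: distrib_left mult_scale_right intro: span_add span_scale span_zero\<close>)
  have mult: "x * y \<in> ?S" if "x \<in> ?S" "y \<in> ?S" for x y
    using that(1)
    by (induction rule: span_induct_alt)
      (use that(2) left in \<open>auto simp: distrib_right mult_scale_left intro: span_add span_scale span_zero\<close>)
  have G: "grouplikes \<subseteq> ?S"
    using gwordsI[of _ "[]" alphabet_words] by (auto intro: span_base)
  moreover have "a ` {..<n} \<subseteq> ?S"
    using gwordsI[OF one_grouplike, of "[_]" alphabet_words] by (auto intro: span_base)
  moreover have "subalgebra ?S"
    unfolding subalgebra_def using mult G one_grouplike subspace_span by blast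
  ultimately have "subalgebra hull (grouplikes \<union> a ` {..<n}) \<subseteq> ?S" by (intro hull_minimal) auto
  with generated show ?thesis by auto
qed

lemma span_gwords_normal: "span (gwords {w. normal w}) = UNIV"
proof -
  have "gwords alphabet_words \<subseteq> span (gwords {w. normal w})"
  proof
    fix x assume "x \<in> gwords alphabet_words"
    then obtain g w where x: "x = g * wval w" "g \<in> grouplikes" "w \<in> alphabet_words"
      by (auto simp: gwords_def)
    then have "x \<in> span (gwords {v. normal v \<and> (v = w \<or> prec v w)})" using span_normal_le by blast
    moreover have "gwords {v. normal v \<and> (v = w \<or> prec v w)} \<subseteq> gwords {w. normal w}"
      by (auto simp: gwords_def)
    ultimately show "x \<in> span (gwords {w. normal w})" using span_mono by blast
  qed
  from span_minimal[OF this subspace_span] show ?thesis using span_gwords by auto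
qed

text \<open>
  Pairing the coproduct with a form vanishing on \<open>below w\<close> and with a form dual to a single
  group-like separates the group-likes in front of \<open>w\<close>.
\<close>

lemma normal_coeff_zero:
  assumes w: "normal w" and T: "finite T" "T \<subseteq> grouplikes"
    and sum: "(\<Sum>g\<in>T. scale (c g) (g * wval w)) \<in> below w" and g0: "g0 \<in> T"
  shows "c g0 = 0"
proof -
  have ww: "w \<in> alphabet_words" using w by (simp add: normal_def)
  have "g0 * wval w \<notin> below w" using normal_grouplike w T g0 by blast
  then obtain \<psi> where \<psi>: "lin_form scale \<psi>" "\<And>y. y \<in> below w \<Longrightarrow> \<psi> y = 0" "\<psi> (g0 * wval w) = 1"
    unfolding below_def by (rule lin_form_separate) blast
  obtain \<theta> where \<theta>: "lin_form scale \<theta>"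
    "\<And>g. g \<in> grouplikes \<Longrightarrow> \<theta> g = (if g = g0 then 1 else 0)"
    using lin_form_extend[OF independent_grouplikes, of "\<lambda>g. if g = g0 then 1 else 0"] by blast
  define F where "F = coprod_form (\<lambda>x y. \<psi> x * \<theta> y)"
  have b: "bilin_form (\<lambda>x y. \<psi> x * \<theta> y)" by (rule bilin_form_prod[OF \<psi>(1) \<theta>(1)])
  have F: "lin_form scale F" unfolding F_def by (rule lin_form_coprod_form[OF b])
  have less: "\<psi> (g * (wgrp v * wval u)) = 0"
    if "g \<in> grouplikes" "u \<in> alphabet_words" "v \<in> alphabet_words" "prec u w" for g u v
  proof -
    have "(g * wgrp v) * wval u \<in> below w"
      using that by (intro in_below mult_grouplike wgrp_grouplike)
    with \<psi>(2) show ?thesis by (simp add: mult.assoc)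
  qed
  have F_below: "F x = 0" if "x \<in> below w" for x
  proof (rule lin_form_vanishes_on_span[OF F _ that[unfolded below_def]])
    fix x assume "x \<in> gwords {v \<in> alphabet_words. prec v w}"
    then obtain g w' where x: "x = g * wval w'" "g \<in> grouplikes" "w' \<in> alphabet_words" "prec w' w"
      by (auto simp: gwords_def)
    show "F x = 0"
      unfolding F_def x(1) coprod_form_grouplike_wval[OF x(2,3) b]
    proof (rule usum_eq_0)
      fix u v assume uv: "w' \<in> shuffles u v"
      with x have "u \<in> alphabet_words" "v \<in> alphabet_words" using shuffles_alphabet_words by blast+
      moreover have "prec u w"
      proof (cases "v = []")
        case False
        then have "length u < length w'" using length_shuffles[OF uv] by simp
        with x(4) show ?thesis by (auto simp: prec_def)
      qed (use uv x in auto)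
      ultimately show "\<psi> (g * (wgrp v * wval u)) * \<theta> (g * wval v) = 0"
        using less x by simp
    qed
  qed
  \<comment> \<open>Only the distribution with empty right word survives, since every other left
    word is shorter than \<open>w\<close>. Its value is
    \<open>\<psi> (g * wval w) * \<theta> g\<close>, so \<open>\<psi>\<close> need only be known at
    the single group-like \<open>g0\<close>.\<close>
  have F_w: "F (g * wval w) = (if g = g0 then 1 else 0)" if g: "g \<in> grouplikes" for g
  proof -
    have "F (g * wval w) = \<psi> (g * (wgrp [] * wval w)) * \<theta> (g * wval [])"
      unfolding F_def coprod_form_grouplike_wval[OF g ww b]
    proof (rule usum_Nil_right)
      fix u v assume uv: "w \<in> shuffles u v" "v \<noteq> []"
      with ww have "u \<in> alphabet_words" "v \<in> alphabet_words" using shuffles_alphabet_words by blast+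
      moreover have "prec u w" using length_shuffles[OF uv(1)] uv(2) by (auto simp: prec_def)
      ultimately show "\<psi> (g * (wgrp v * wval u)) * \<theta> (g * wval v) = 0" using less g by simp
    qed
    with \<theta>(2)[OF g] \<psi>(3) show ?thesis by simp
  qed
  have "0 = F (\<Sum>g\<in>T. scale (c g) (g * wval w))" using F_below[OF sum] by simp
  also have "\<dots> = (\<Sum>g\<in>T. c g * F (g * wval w))"
    by (simp add: lin_form_sum[OF F] lin_form_scale[OF F])
  also have "\<dots> = (\<Sum>g\<in>T. if g0 = g then c g else 0)"
    by (intro sum.cong) (use F_w T in auto)
  also have "\<dots> = c g0" using T g0 by simp
  finally show ?thesis by simp
qed

text \<open>Let \<open>w0\<close> be the \<open>prec\<close>-greatest word with a nonzero
  coefficient. All terms with other words lie in \<open>below w0\<close>, so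
  \<open>normal_coeff_zero\<close> applies to the group-likes in front of \<open>w0\<close>.\<close>

lemma normal_family_zero:
  assumes S: "finite S" "S \<subseteq> grouplikes \<times> {w. normal w}"
    and sum: "(\<Sum>(g, w)\<in>S. scale (c (g, w)) (g * wval w)) = 0"
  shows "\<forall>s\<in>S. c s = 0"
proof (rule ccontr)
  assume nz: "\<not> (\<forall>s\<in>S. c s = 0)"
  define S' where "S' = {s \<in> S. c s \<noteq> 0}"
  have S': "finite S'" "S' \<noteq> {}" using S nz by (auto simp: S'_def)
  have ex: "\<exists>w0\<in>W. \<forall>w\<in>W. w = w0 \<or> prec w w0" if "finite W" "W \<noteq> {}" for W
    using that
  proof (induction rule: finite_ne_induct)
    case (insert w W)
    then obtain w0 where w0: "w0 \<in> W" "\<forall>w\<in>W. w = w0 \<or> prec w w0" by blast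
    from prec_total[of w w0] consider "w = w0" | "prec w w0" | "prec w0 w" by blast
    then show ?case
    proof cases
      case 3
      with w0 have "\<forall>v\<in>insert w W. v = w \<or> prec v w" using prec_trans[OF _ 3] by auto
      then show ?thesis by blast
    qed (use w0 in auto)
  qed auto
  obtain w0 where w0: "w0 \<in> snd ` S'" "\<forall>w\<in>snd ` S'. w = w0 \<or> prec w w0"
    using ex[of "snd ` S'"] S' by auto
  define T where "T = {g. (g, w0) \<in> S'}"
  have T_eq: "{s \<in> S'. snd s = w0} = (\<lambda>g. (g, w0)) ` T" by (auto simp: T_def)
  have fT: "finite T" unfolding T_def
    by (rule finite_subset[OF _ finite_imageI[OF S'(1), of fst]]) force
  have TG: "T \<subseteq> grouplikes" using S by (auto simp: T_def S'_def)
  have norm: "normal w0" using w0(1) S by (auto simp: S'_def)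
  have "(\<Sum>(g, w)\<in>S. scale (c (g, w)) (g * wval w)) = (\<Sum>(g, w)\<in>S'. scale (c (g, w)) (g * wval w))"
    by (rule sum.mono_neutral_right) (use S in \<open>auto simp: S'_def\<close>)
  also have "\<dots> = (\<Sum>(g, w)\<in>{s \<in> S'. snd s = w0}. scale (c (g, w)) (g * wval w)) +
      (\<Sum>(g, w)\<in>S' - {s \<in> S'. snd s = w0}. scale (c (g, w)) (g * wval w))"
    by (rule sum.subset_diff[THEN trans, OF _ _ add.commute]) (use S' in auto)
  also have "(\<Sum>(g, w)\<in>{s \<in> S'. snd s = w0}. scale (c (g, w)) (g * wval w)) =
      (\<Sum>g\<in>T. scale (c (g, w0)) (g * wval w0))"
    unfolding T_eq by (subst sum.reindex) (auto simp: inj_on_def)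
  finally have "(\<Sum>g\<in>T. scale (c (g, w0)) (g * wval w0)) =
      - (\<Sum>(g, w)\<in>S' - {s \<in> S'. snd s = w0}. scale (c (g, w)) (g * wval w))"
    using sum by (simp add: eq_neg_iff_add_eq_0)
  also have "\<dots> \<in> below w0"
    unfolding below_def
  proof (intro span_neg span_sum)
    fix s assume s: "s \<in> S' - {s \<in> S'. snd s = w0}"
    obtain g w where gw: "s = (g, w)" by (cases s)
    with s w0(2) have "prec w w0" by force
    moreover have "g \<in> grouplikes" "w \<in> alphabet_words" using s gw S by (auto simp: S'_def normal_def)
    ultimately have "g * wval w \<in> span (gwords {v \<in> alphabet_words. prec v w0})"
      by (intro span_base gwordsI) auto
    then show "(case s of (g, w) \<Rightarrow> scale (c (g, w)) (g * wval w)) \<in>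
        span (gwords {v \<in> alphabet_words. prec v w0})"
      using gw by (simp add: span_scale)
  qed
  finally have *: "(\<Sum>g\<in>T. scale (c (g, w0)) (g * wval w0)) \<in> below w0" .
  obtain g0 where "(g0, w0) \<in> S'" using w0(1) by auto
  then have "g0 \<in> T" "c (g0, w0) \<noteq> 0" by (auto simp: T_def S'_def)
  with normal_coeff_zero[OF norm fT TG *] show False by blast
qed

lemma inj_on_normal_family: "inj_on (\<lambda>(g, w). g * wval w) (grouplikes \<times> {w. normal w})"
proof (rule inj_onI, rule ccontr)
  fix s s' assume s: "s \<in> grouplikes \<times> {w. normal w}" "s' \<in> grouplikes \<times> {w. normal w}"
    and eq: "(case s of (g, w) \<Rightarrow> g * wval w) = (case s' of (g, w) \<Rightarrow> g * wval w)" and ne: "s \<noteq> s'"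
  have "\<forall>t\<in>{s, s'}. (if t = s then 1 else - 1 :: 'k) = 0"
    by (rule normal_family_zero)
      (use s eq ne in \<open>auto simp: case_prod_beta\<close>)
  then show False by auto
qed

lemma independent_normal_family:
  "independent ((\<lambda>(g, w). g * wval w) ` (grouplikes \<times> {w. normal w}))"
  unfolding independent_explicit_finite_subsets
proof (intro allI impI ballI)
  let ?f = "\<lambda>(g, w). g * wval w"
  fix A u v assume A: "A \<subseteq> ?f ` (grouplikes \<times> {w. normal w})" "finite A"
    and sum: "(\<Sum>x\<in>A. scale (u x) x) = 0" and v: "v \<in> A"
  obtain S where S: "S \<subseteq> grouplikes \<times> {w. normal w}" "finite S" "A = ?f ` S"
    using A by (metis finite_subset_image)
  have inj: "inj_on ?f S" using inj_on_subset[OF inj_on_normal_family S(1)] .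
  have "(\<Sum>(g, w)\<in>S. scale ((\<lambda>s. u (?f s)) (g, w)) (g * wval w)) = (\<Sum>x\<in>A. scale (u x) x)"
    unfolding S(3) sum.reindex[OF inj] by (simp add: case_prod_beta)
  with sum normal_family_zero[OF S(2,1), of "\<lambda>s. u (?f s)"] have "\<forall>s\<in>S. u (?f s) = 0" by simp
  with v S(3) show "u v = 0" by auto
qed

text \<open>The form is 1 on \<open>g * wval w\<close> for all group-likes at once: the coproduct
  puts some \<open>wgrp v\<close> in front of the left word, and the pairing must not depend on
  it.\<close>

lemma dual_form:
  assumes w: "normal w"
  obtains \<phi> where "lin_form scale \<phi>" "\<And>g. g \<in> grouplikes \<Longrightarrow> \<phi> (g * wval w) = 1"
    "\<And>x. x \<in> below w \<Longrightarrow> \<phi> x = 0"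
proof -
  obtain \<phi> where \<phi>: "lin_form scale \<phi>" "\<And>b. b \<in> (\<lambda>(g, w). g * wval w) ` (grouplikes \<times> {w. normal w}) \<Longrightarrow>
      \<phi> b = (if b \<in> gwords {w} then 1 else 0)"
    using lin_form_extend[OF independent_normal_family, of "\<lambda>b. if b \<in> gwords {w} then 1 else 0"]
    by blast
  show ?thesis
  proof (rule that[OF \<phi>(1)])
    fix g assume "g \<in> grouplikes"
    then show "\<phi> (g * wval w) = 1" using w by (subst \<phi>(2)) (auto intro!: gwordsI image_eqI)
  next
    fix x assume "x \<in> below w"
    then have "x \<in> span (gwords {v. normal v \<and> prec v w})" using below_normal by blast
    then show "\<phi> x = 0"
    proof (rule lin_form_vanishes_on_span[OF \<phi>(1), rotated])
      fix y assume "y \<in> gwords {v. normal v \<and> prec v w}"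
      then obtain g v where y: "y = g * wval v" "g \<in> grouplikes" "normal v" "prec v w"
        by (auto simp: gwords_def)
      have "y \<notin> gwords {w}"
      proof
        assume "y \<in> gwords {w}"
        then obtain h where h: "y = h * wval w" "h \<in> grouplikes" by (auto simp: gwords_def)
        from inj_onD[OF inj_on_normal_family, of "(g, v)" "(h, w)"] h y w have "v = w" by simp
        with y prec_irrefl show False by simp
      qed
      with y show "\<phi> y = 0" by (subst \<phi>(2)) auto
    qed
  qed
qed

text \<open>The product of the forms dual to \<open>x\<close> and \<open>y\<close>, paired with the
  coproduct, vanishes on \<open>below w\<close>, but on \<open>wval w\<close> it gives the
  coefficient assumed nonzero. So \<open>wval w\<close> is not in \<open>below w\<close>.\<close>

lemma normal_from_shuffles:
  assumes x: "normal x" and y: "normal y" and w: "w \<in> alphabet_words" "length w = length x + length y"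
    and max: "\<And>z. z \<in> shuffles x y \<Longrightarrow> z \<le> w"
    and nz: "usum (\<lambda>i j. chi i (ga j)) w (wdelta x y) \<noteq> 0"
  shows "normal w"
proof (rule ccontr)
  assume "\<not> normal w"
  with w have wb: "wval w \<in> below w" by (simp add: normal_def)
  obtain \<phi> where \<phi>: "lin_form scale \<phi>" "\<And>g. g \<in> grouplikes \<Longrightarrow> \<phi> (g * wval x) = 1"
    "\<And>z. z \<in> below x \<Longrightarrow> \<phi> z = 0" using dual_form[OF x] by blast
  obtain \<psi> where \<psi>: "lin_form scale \<psi>" "\<And>g. g \<in> grouplikes \<Longrightarrow> \<psi> (g * wval y) = 1"
    "\<And>z. z \<in> below y \<Longrightarrow> \<psi> z = 0" using dual_form[OF y] by blast
  define F where "F = coprod_form (\<lambda>x y. \<phi> x * \<psi> y)"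
  have b: "bilin_form (\<lambda>x y. \<phi> x * \<psi> y)" by (rule bilin_form_prod[OF \<phi>(1) \<psi>(1)])
  have F: "lin_form scale F" unfolding F_def by (rule lin_form_coprod_form[OF b])
  have zero: "\<phi> (g * (wgrp v * wval u)) * \<psi> (g * wval v) = 0"
    if g: "g \<in> grouplikes" and w': "w' \<in> alphabet_words" "w' = w \<or> prec w' w"
      and uv: "w' \<in> shuffles u v" "\<not> (u = x \<and> v = y \<and> w' = w)" for g w' u v
  proof -
    have u: "u \<in> alphabet_words" and v: "v \<in> alphabet_words"
      using w' uv shuffles_alphabet_words by blast+
    \<comment> \<open>Otherwise counting lengths makes all lengths agree, so
      \<open>u \<le> x\<close> and \<open>v \<le> y\<close>, and maximality of \<open>w\<close>
      bounds \<open>w'\<close> by \<open>w\<close>. But a preceding word of equal length is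
      lexicographically larger, so \<open>w' = w\<close>, and the equality case leaves only the
      excluded pair.\<close>
    have "prec u x \<or> prec v y"
    proof (rule ccontr)
      assume *: "\<not> (prec u x \<or> prec v y)"
      then have "length u \<ge> length x" "length v \<ge> length y" by (auto simp: prec_def)
      moreover have "length w' \<le> length w" using w' by (auto simp: prec_def)
      ultimately have len: "length u = length x" "length v = length y" "length w' = length w"
        using length_shuffles[OF uv(1)] w(2) by auto
      with * have le: "u \<le> x" "v \<le> y" by (auto simp: prec_def)
      note m = shuffles_le_max[OF uv(1) len(1,2) le max]
      from m(1) w' len have "w' = w" by (auto simp: prec_def)
      with m(2) uv(2) show False by simp
    qed
    then show ?thesis
    proof
      assume "prec u x"
      then have "(g * wgrp v) * wval u \<in> below x"
        using g u v by (intro in_below mult_grouplike wgrp_grouplike)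
      with \<phi>(3) show ?thesis by (simp add: mult.assoc)
    next
      assume "prec v y"
      then have "g * wval v \<in> below y" using g v by (intro in_below)
      with \<psi>(3) show ?thesis by simp
    qed
  qed
  have "F (wval w) = 0"
  proof (rule lin_form_vanishes_on_span[OF F _ wb[unfolded below_def]])
    fix z assume "z \<in> gwords {v \<in> alphabet_words. prec v w}"
    then obtain g w' where z: "z = g * wval w'" "g \<in> grouplikes" "w' \<in> alphabet_words" "prec w' w"
      by (auto simp: gwords_def)
    show "F z = 0"
      unfolding F_def z(1) coprod_form_grouplike_wval[OF z(2,3) b]
    proof (rule usum_eq_0)
      fix u v assume "w' \<in> shuffles u v"
      then show "\<phi> (g * (wgrp v * wval u)) * \<psi> (g * wval v) = 0"
        by (intro zero[of g w']) (use z prec_irrefl in auto)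
    qed
  qed
  moreover have "F (wval w) = usum (\<lambda>i j. chi i (ga j)) w (wdelta x y)"
    unfolding F_def coprod_form_wval[OF w(1) b]
  proof (rule usum_cong)
    fix u v assume uv: "w \<in> shuffles u v"
    show "\<phi> (wgrp v * wval u) * \<psi> (wval v) = wdelta x y u v"
    proof (cases "u = x \<and> v = y")
      case True
      have "v \<in> alphabet_words" using uv w shuffles_alphabet_words by blast
      with True \<phi>(2)[OF wgrp_grouplike[of v]] \<psi>(2)[OF one_grouplike] show ?thesis
        by (simp add: wdelta_def)
    next
      case False
      with zero[OF one_grouplike w(1) _ uv] show ?thesis by (auto simp: wdelta_def)
    qed
  qed
  ultimately show False using nz by simp
qed

section \<open>Normality of powers and products of Lyndon words\<close>

lemma normal_wpow_append:
  assumes "lyndon l" "v < l" "normal (wpow l k)" "normal v"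
  shows "normal (wpow l k @ v)"
proof (cases k)
  case (Suc k')
  have l: "l \<in> alphabet_words" using assms(3) Suc by (simp add: normal_def)
  show ?thesis
  proof (rule normal_from_shuffles[OF assms(3,4)])
    show "usum (\<lambda>i j. chi i (ga j)) (wpow l k @ v) (wdelta (wpow l k) v) \<noteq> 0"
      unfolding usum_wpow_append[OF assms(1,2)]
      using chi_pair_nonzero l assms(4) by (simp add: normal_def)
  qed (use assms shuffles_wpow_le in \<open>auto simp: normal_def\<close>)
qed (use assms in simp)

lemma normal_wpow_mono:
  assumes "normal (wpow l k)" "j \<le> k"
  shows "normal (wpow l j)"
proof -
  have "wpow l k = [] @ wpow l j @ wpow l (k - j)" using assms(2) by (simp flip: wpow_add)
  with normal_subword[of "[]"] assms(1) show ?thesis by metis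
qed

text \<open>For the least non-normal exponent all smaller powers are normal, so
  \<open>normal_from_shuffles\<close> would apply to any splitting with a nonzero Gaussian
  binomial.\<close>

lemma not_normal_wpow:
  assumes l: "lyndon l" and nn: "\<not> normal (wpow l k)" and w: "l \<in> alphabet_words"
  obtains s where "s \<le> k" "\<not> normal (wpow l s)" "gbin_vanish (chi_pair l l) s"
proof -
  define s where "s = (LEAST s. \<not> normal (wpow l s))"
  have s: "\<not> normal (wpow l s)" "s \<le> k"
    unfolding s_def by (rule LeastI[of _ k], rule nn, rule Least_le, rule nn)
  have less: "normal (wpow l j)" if "j < s" for j
    using not_less_Least[of j "\<lambda>s. \<not> normal (wpow l s)"] that unfolding s_def by blast
  have "gbin_vanish (chi_pair l l) s"
    unfolding gbin_vanish_def
  proof (intro conjI allI impI)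
    show "0 < s" using s normal_Nil by (cases s) auto
    fix i j assume ij: "0 < i" "0 < j" "i + j = s"
    show "gbin (chi_pair l l) i j = 0"
    proof (rule ccontr)
      assume nz: "gbin (chi_pair l l) i j \<noteq> 0"
      have "normal (wpow l (i + j))"
      proof (rule normal_from_shuffles)
        show "normal (wpow l i)" "normal (wpow l j)" using less ij by auto
        show "wpow l (i + j) \<in> alphabet_words" using w by (auto simp: alphabet_words_def wpow_def)
        show "usum (\<lambda>i j. chi i (ga j)) (wpow l (i + j)) (wdelta (wpow l i) (wpow l j)) \<noteq> 0"
          using nz by (simp add: usum_wpow_wpow[OF l])
      qed (use shuffles_wpow_wpow_le[OF l] in \<open>auto simp: add_mult_distrib\<close>)
      with s ij show False by simp
    qed
  qed
  with s that show ?thesis by blast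
qed

text \<open>If the power were not normal, some place \<open>s\<close> not exceeding its exponent
  would have \<open>wpow l s\<close> non-normal. All places in use are normal, hence below
  \<open>s\<close>, and \<open>expansion_value_less\<close> makes the exponent less than
  \<open>s\<close>.\<close>

lemma normal_wpow_expansion:
  assumes l: "lyndon l" "l \<in> alphabet_words" and ds: "expansion (chi_pair l l) ds"
  shows "normal (wpow l (expansion_value ds)) \<longleftrightarrow> (\<forall>(e, d)\<in>set ds. normal (wpow l e))"
proof
  assume norm: "normal (wpow l (expansion_value ds))"
  have "normal (wpow l e)" if "(e, d) \<in> set ds" for e d
  proof (rule normal_wpow_mono[OF norm])
    have "d > 0" using ds that by (auto simp: expansion_def)
    then have "e \<le> e * d" by simp
    also have "\<dots> \<le> expansion_value ds"
      unfolding expansion_value_def by (rule member_le_sum_list) (use that in force, simp)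
    finally show "e \<le> expansion_value ds" .
  qed
  then show "\<forall>(e, d)\<in>set ds. normal (wpow l e)" by auto
next
  assume *: "\<forall>(e, d)\<in>set ds. normal (wpow l e)"
  show "normal (wpow l (expansion_value ds))"
  proof (rule ccontr)
    assume "\<not> ?thesis"
    from not_normal_wpow[OF l(1) this l(2)] obtain s where s: "s \<le> expansion_value ds"
      "\<not> normal (wpow l s)" "gbin_vanish (chi_pair l l) s" by blast
    have "fst x < s" if "x \<in> set ds" for x
      using * s(2) that normal_wpow_mono[of l "fst x" s] by (force simp: not_less)
    with expansion_value_less[OF ds s(3)] s(1) show False by auto
  qed
qed

end

subsection \<open>The basis\<close>

lemma sorted_wrt_set_unique:
  assumes asym: "\<And>x y. R x y \<Longrightarrow> \<not> R y x"
    and "sorted_wrt R xs" "sorted_wrt R ys" "set xs = set ys"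
  shows "xs = ys"
  using assms(2-4)
proof (induction xs arbitrary: ys)
  case (Cons x xs)
  then obtain y ys' where ys: "ys = y # ys'" by (cases ys) auto
  have "x = y"
  proof (rule ccontr)
    assume "x \<noteq> y"
    with Cons.prems ys have "x \<in> set ys'" "y \<in> set xs" by (metis list.set_intros(1) set_ConsD)+
    with Cons.prems ys have "R y x" "R x y" by auto
    with asym show False by blast
  qed
  moreover have "\<not> R z z" for z using asym by blast
  with Cons.prems ys have "x \<notin> set xs" "y \<notin> set ys'" by auto
  then have "set xs = set ys'" using Cons.prems(3) ys \<open>x = y\<close> by (auto simp: set_eq_iff)
  ultimately show ?case using Cons ys by auto
qed simp

lemma count_list_replicate: "count_list (replicate k x) y = (if x = y then k else 0)"
  by (induction k) auto

text \<open>Whole blocks of equal factors are split off, so that the remaining ones are strictly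
  below \<open>l\<close>; \<open>concat_less_lyndon\<close> needs this strictness to supply the
  hypothesis of \<open>normal_wpow_append\<close>.\<close>

lemma lyndon_fact_induct [consumes 1, case_names Nil block]:
  assumes "lyndon_fact ls"
    and "Q []"
    and block: "\<And>l k ls. lyndon l \<Longrightarrow> 0 < k \<Longrightarrow> lyndon_fact ls \<Longrightarrow> (\<And>m. m \<in> set ls \<Longrightarrow> m < l) \<Longrightarrow>
      Q ls \<Longrightarrow> Q (replicate k l @ ls)"
  shows "Q ls"
  using assms(1)
proof (induction "length ls" arbitrary: ls rule: less_induct)
  case less
  show ?case
  proof (cases ls)
    case Nil
    with assms(2) show ?thesis by simp
  next
    case (Cons l xs)
    define k where "k = length (takeWhile ((=) l) ls)"
    define ys where "ys = dropWhile ((=) l) ls"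
    have rep: "takeWhile ((=) l) ls = replicate k l"
      unfolding k_def by (rule replicate_eqI) (auto dest: set_takeWhileD)
    have ls: "ls = replicate k l @ ys" unfolding ys_def rep[symmetric] by simp
    have k: "k > 0" using Cons by (simp add: k_def)
    have l: "lyndon l" and ys: "lyndon_fact ys" using less.prems Cons
      by (auto simp: lyndon_fact_Cons) (metis ls Cons less.prems lyndon_fact_def sorted_wrt_append Un_iff set_append)
    have lt: "m < l" if mem: "m \<in> set ys" for m
    proof -
      obtain y zs where y: "ys = y # zs" using mem by (cases ys) auto
      have "y \<in> set ls" by (subst ls) (simp add: y)
      then have "y \<le> l" using less.prems Cons by (auto simp: lyndon_fact_Cons)
      moreover have "y \<noteq> l" using hd_dropWhile[of "(=) l" ls] y unfolding ys_def by auto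
      moreover have "m \<le> y" using mem y ys by (auto simp: lyndon_fact_Cons)
      ultimately show ?thesis by auto
    qed
    have "Q ys" by (rule less.hyps[OF _ ys]) (use ls k in \<open>metis length_append length_replicate less_add_same_cancel2\<close>)
    with block[OF l k ys lt] ls show ?thesis by simp
  qed
qed

context character_hopf_algebra
begin

lemma normal_concat:
  assumes "lyndon_fact ls" "\<And>l. l \<in> set ls \<Longrightarrow> normal (wpow l (count_list ls l))"
  shows "normal (concat ls)"
  using assms
proof (induction rule: lyndon_fact_induct)
  case Nil
  show ?case by (simp add: normal_Nil)
next
  case (block l k ls)
  have "l \<notin> set ls" using block.hyps(4) by blast
  then have "count_list (replicate k l @ ls) l = k"
    by (simp add: count_list_replicate)
  with block.prems[of l] block.hyps(2) have "normal (wpow l k)" by simp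
  moreover have "normal (concat ls)"
  proof (rule block.IH)
    fix m assume m: "m \<in> set ls"
    with block.hyps(4) have "m \<noteq> l" by blast
    then have "count_list (replicate k l @ ls) m = count_list ls m" by (simp add: count_list_replicate)
    with block.prems[of m] m show "normal (wpow m (count_list ls m))" by simp
  qed
  ultimately have "normal (wpow l k @ concat ls)"
    using block by (intro normal_wpow_append concat_less_lyndon)
  then show ?case by (simp add: wpow_def)
qed

section \<open>Generators indexed by Lyndon words and place values\<close>

definition pbw_index :: "(nat list \<times> nat) set" where
  "pbw_index = {(l, e). lyndon l \<and> gbin_vanish (chi_pair l l) e \<and> normal (wpow l e)}"

definition pbw_gen :: "nat list \<times> nat \<Rightarrow> 'a" where
  "pbw_gen = (\<lambda>(l, e). wval (wpow l e))"

text \<open>Lyndon words descend, as in their factorization, and the places of one Lyndon word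
  ascend, as in \<open>expansion\<close>. An ordered PBW word thus multiplies out to an already
  factored word.\<close>

definition index_less :: "nat list \<times> nat \<Rightarrow> nat list \<times> nat \<Rightarrow> bool" where
  "index_less = (\<lambda>(l, e) (l', e'). l' < l \<or> l = l' \<and> e < e')"

definition index_height :: "nat list \<times> nat \<Rightarrow> enat" where
  "index_height = (\<lambda>(l, e). next_vanish (chi_pair l l) e)"

definition index_words :: "((nat list \<times> nat) \<times> nat) list set" where
  "index_words = {ws. sorted_wrt (\<lambda>x y. index_less (fst x) (fst y)) ws \<and>
     (\<forall>(i, d)\<in>set ws. i \<in> pbw_index \<and> 0 < d \<and> enat d < index_height i)}"

definition index_fact :: "((nat list \<times> nat) \<times> nat) list \<Rightarrow> nat list list" where
  "index_fact ws = concat (map (\<lambda>((l, e), d). replicate (e * d) l) ws)"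

definition index_digits :: "nat list \<Rightarrow> ((nat list \<times> nat) \<times> nat) list \<Rightarrow> (nat \<times> nat) list" where
  "index_digits l ws = map (\<lambda>((l, e), d). (e, d)) (filter (\<lambda>x. fst (fst x) = l) ws)"

lemma index_fact_simps [simp]:
  "index_fact [] = []"
  "index_fact (((l, e), d) # ws) = replicate (e * d) l @ index_fact ws"
  "index_fact (vs @ ws) = index_fact vs @ index_fact ws"
  by (simp_all add: index_fact_def)

lemma set_index_fact: "l \<in> set (index_fact ws) \<Longrightarrow> \<exists>e d. ((l, e), d) \<in> set ws"
  by (auto simp: index_fact_def)

lemma lyndon_fact_index_fact:
  assumes "ws \<in> index_words"
  shows "lyndon_fact (index_fact ws)"
  using assms
proof (induction ws)
  case Nil
  then show ?case by (simp add: lyndon_fact_def)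
next
  case (Cons x ws)
  obtain l e d where x: "x = ((l, e), d)" by (metis prod.exhaust)
  from Cons have IH: "lyndon_fact (index_fact ws)" by (auto simp: index_words_def)
  have "m \<le> l" if "m \<in> set (index_fact ws)" for m
    using set_index_fact[OF that] Cons.prems x by (fastforce simp: index_words_def index_less_def)
  moreover have "lyndon l" using Cons.prems x by (auto simp: index_words_def pbw_index_def)
  moreover have "sorted_wrt (\<ge>) (replicate k l)" for k by (induction k) auto
  ultimately show ?case using IH x by (auto simp: lyndon_fact_def sorted_wrt_append)
qed

lemma expansion_index_digits:
  assumes "ws \<in> index_words"
  shows "expansion (chi_pair l l) (index_digits l ws)"
  using assms
proof (induction ws)
  case Nil
  then show ?case by (simp add: index_digits_def expansion_def)
next
  case (Cons x ws)
  then have "ws \<in> index_words" by (auto simp: index_words_def)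
  with Cons.IH have IH: "expansion (chi_pair l l) (index_digits l ws)" .
  show ?case
  proof (cases "fst (fst x) = l")
    case True
    then obtain e d where x: "x = ((l, e), d)" by (metis prod.collapse)
    have "gbin_vanish (chi_pair l l) e" "0 < d" "enat d < next_vanish (chi_pair l l) e"
      using Cons.prems x by (auto simp: index_words_def pbw_index_def index_height_def)
    moreover have "e < fst y" if "y \<in> set (index_digits l ws)" for y
      using that Cons.prems x by (auto simp: index_digits_def index_words_def index_less_def)
    ultimately show ?thesis using IH x by (auto simp: index_digits_def expansion_def)
  qed (use IH in \<open>simp add: index_digits_def\<close>)
qed

lemma count_list_index_fact: "count_list (index_fact ws) l = expansion_value (index_digits l ws)"
  by (induction ws) (auto simp: index_digits_def expansion_value_def count_list_replicate)

lemma index_wordsD: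
  assumes "ws \<in> index_words" "((l, e), d) \<in> set ws"
  shows "lyndon l" "normal (wpow l e)" "0 < e" "l \<in> alphabet_words"
proof -
  show l: "lyndon l" "normal (wpow l e)" "0 < e"
    using assms by (auto simp: index_words_def pbw_index_def gbin_vanish_pos)
  then show "l \<in> alphabet_words" by (cases e) (auto simp: normal_def)
qed

text \<open>The word determines its Lyndon factorization, this the multiplicity of each Lyndon word,
  and the multiplicity its digits. The digits give the set of entries, and the ordering the
  list.\<close>

lemma inj_on_index_words: "inj_on (concat \<circ> index_fact) index_words"
proof (rule inj_onI)
  fix ws ws' assume ws: "ws \<in> index_words" "ws' \<in> index_words"
    and eq: "(concat \<circ> index_fact) ws = (concat \<circ> index_fact) ws'"
  then have "index_fact ws = index_fact ws'"
    by (intro lyndon_fact_unique lyndon_fact_index_fact) simp_all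
  then have dig: "index_digits l ws = index_digits l ws'" for l
    using expansion_unique[OF expansion_index_digits[OF ws(1)] expansion_index_digits[OF ws(2)]]
    by (metis count_list_index_fact)
  have mem: "((l, e), d) \<in> set vs \<longleftrightarrow> (e, d) \<in> set (index_digits l vs)" for l e d vs
    by (force simp: index_digits_def)
  have "set ws = set ws'" using dig mem by (auto simp: set_eq_iff)
  then show "ws = ws'"
    by (rule sorted_wrt_set_unique[rotated 3, where R = "\<lambda>x y. index_less (fst x) (fst y)"])
      (use ws in \<open>auto simp: index_words_def index_less_def\<close>)
qed

lemma normal_index_words:
  assumes ws: "ws \<in> index_words"
  shows "normal (concat (index_fact ws))"
proof (rule normal_concat[OF lyndon_fact_index_fact[OF ws]])
  fix l assume "l \<in> set (index_fact ws)"
  then obtain e d where "((l, e), d) \<in> set ws" using set_index_fact by blast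
  note l = index_wordsD(1,4)[OF ws this]
  have "normal (wpow l (expansion_value (index_digits l ws)))"
    unfolding normal_wpow_expansion[OF l expansion_index_digits[OF ws]]
    using index_wordsD(2)[OF ws] by (force simp: index_digits_def)
  then show "normal (wpow l (count_list (index_fact ws) l))"
    by (simp add: count_list_index_fact)
qed

text \<open>The last clause serves the induction: it keeps the Lyndon words of the remaining entries
  below \<open>l\<close>, so that the entries for the block of \<open>l\<close> may be put in
  front.\<close>

lemma index_words_exist:
  assumes "lyndon_fact ls" "normal (concat ls)"
  shows "\<exists>ws\<in>index_words. index_fact ws = ls \<and> (\<forall>x\<in>set ws. fst (fst x) \<in> set ls)"
  using assms
proof (induction rule: lyndon_fact_induct)
  case Nil
  show ?case by (intro bexI[of _ "[]"]) (auto simp: index_words_def)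
next
  case (block l k ls)
  have eq: "concat (replicate k l @ ls) = wpow l k @ concat ls" by (simp add: wpow_def)
  have "normal (concat ls)" "normal (wpow l k)"
    using normal_subword[of "wpow l k" "concat ls" "[]"] normal_subword[of "[]" "wpow l k" "concat ls"]
      block.prems eq by auto
  with block.IH obtain ws where ws: "ws \<in> index_words" "index_fact ws = ls"
    "\<And>x. x \<in> set ws \<Longrightarrow> fst (fst x) \<in> set ls" by blast
  obtain ds where ds: "expansion (chi_pair l l) ds" "expansion_value ds = k"
    using expansion_exists by blast
  have "l \<in> alphabet_words" using \<open>normal (wpow l k)\<close> block.hyps(2) by (cases k) (auto simp: normal_def)
  with normal_wpow_expansion[OF block.hyps(1) _ ds(1)] \<open>normal (wpow l k)\<close> ds(2)
  have norm: "\<forall>(e, d)\<in>set ds. normal (wpow l e)" by simp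
  define vs where "vs = map (\<lambda>(e, d). ((l, e), d)) ds"
  have fact: "index_fact vs = replicate (expansion_value ds) l"
    unfolding vs_def expansion_value_def by (induction ds) (auto simp: replicate_add)
  have less: "index_less (fst x) (fst y)" if "x \<in> set vs" "y \<in> set ws" for x y
  proof -
    have "fst (fst y) < l" using ws(3)[OF that(2)] block.hyps(4) by blast
    moreover have "fst (fst x) = l" using that(1) by (auto simp: vs_def)
    ultimately show ?thesis by (simp add: index_less_def case_prod_beta)
  qed
  have sorted: "sorted_wrt (\<lambda>x y. index_less (fst x) (fst y)) vs"
    unfolding vs_def sorted_wrt_map
    by (rule sorted_wrt_mono_rel[of _ "\<lambda>x y. fst x < fst y"])
      (use ds(1) in \<open>auto simp: expansion_def index_less_def\<close>)
  have "\<forall>(i, d)\<in>set vs. i \<in> pbw_index \<and> 0 < d \<and> enat d < index_height i"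
    using ds(1) norm block.hyps(1) by (auto simp: vs_def expansion_def pbw_index_def index_height_def)
  with ws(1) sorted less have "vs @ ws \<in> index_words"
    unfolding index_words_def by (simp add: sorted_wrt_append ball_Un)
  moreover have "index_fact (vs @ ws) = replicate k l @ ls"
    using fact ds(2) ws(2) by simp
  moreover have "fst (fst x) \<in> set (replicate k l @ ls)" if "x \<in> set (vs @ ws)" for x
    using that ws(3)[of x] block.hyps(2) by (auto simp: vs_def)
  ultimately show ?case by blast
qed

lemma image_index_words: "(concat \<circ> index_fact) ` index_words = {w. normal w}"
proof (intro subset_antisym subsetI)
  fix w assume "w \<in> {w. normal w}"
  moreover obtain ls where "lyndon_fact ls" "concat ls = w" by (rule lyndon_fact_exists)
  ultimately show "w \<in> (concat \<circ> index_fact) ` index_words" using index_words_exist by fastforce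
qed (auto simp: normal_index_words)

lemma inj_on_pbw_gen: "inj_on pbw_gen pbw_index"
proof (rule inj_onI)
  fix i j assume ij: "i \<in> pbw_index" "j \<in> pbw_index" "pbw_gen i = pbw_gen j"
  obtain l e m f where i: "i = (l, e)" and j: "j = (m, f)" by (metis prod.exhaust)
  from ij i j have *: "lyndon l" "lyndon m" "0 < e" "0 < f" "normal (wpow l e)" "normal (wpow m f)"
    by (auto simp: pbw_index_def gbin_vanish_pos)
  have "wpow l e = wpow m f"
    using inj_onD[OF inj_on_normal_family, of "(1, wpow l e)" "(1, wpow m f)"] * ij i j one_grouplike
    by (simp add: pbw_gen_def)
  moreover have "lyndon_fact (replicate k l)" if "lyndon l" for k and l :: "nat list"
    using that by (induction k) (auto simp: lyndon_fact_def)
  ultimately have "replicate e l = replicate f m"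
    using * by (intro lyndon_fact_unique) (auto simp: wpow_def)
  with * show "i = j" by (metis i j hd_replicate length_replicate less_numeral_extra(3))
qed

lemma pbw_product_index_words:
  "pbw_product (g, map (map_prod pbw_gen id) ws) = g * wval (concat (index_fact ws))"
proof -
  have "prod_list (map (\<lambda>(u, k). u ^ k) (map (map_prod pbw_gen id) ws)) = wval (concat (index_fact ws))"
    by (induction ws) (auto simp: pbw_gen_def wpow_mult wval_wpow simp flip: wpow_def)
  then show ?thesis by (simp add: pbw_product_def)
qed

section \<open>Constitutions of words and the scalar p_uu\<close>

lemma has_constitution_wval: "w \<in> alphabet_words \<Longrightarrow> has_constitution (wval w) (count_list w)"
  unfolding has_constitution_def
  by (intro exI[of _ "Poly_Mapping.single w 1"])
    (auto simp: nc_homogeneous_def nc_value_def wval_def alphabet_words_def)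

lemma constitution_char_wchi:
  "w \<in> alphabet_words \<Longrightarrow> constitution_char (count_list w) g = wchi w g"
proof (induction w)
  case (Cons j w)
  have "constitution_char (count_list (j # w)) g =
      (\<Prod>i<n. (if i = j then chi i g else 1) * chi i g ^ count_list w i)"
    unfolding constitution_char_def by (intro prod.cong) auto
  also have "\<dots> = chi j g * constitution_char (count_list w) g"
    using Cons.prems by (simp add: prod.distrib constitution_char_def)
  also have "constitution_char (count_list w) g = wchi w g" using Cons by simp
  also have "chi j g * wchi w g = wchi (j # w) g" by (simp add: wchi_def)
  finally show ?case .
qed (simp add: constitution_char_def wchi_def)

lemma power_grouplike: "g \<in> grouplikes \<Longrightarrow> g ^ k \<in> grouplikes"
  by (induction k) (auto simp: one_grouplike mult_grouplike)

lemma constitution_group_wgrp: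
  "w \<in> alphabet_words \<Longrightarrow> constitution_group (count_list w) = wgrp w"
proof (induction w)
  case (Cons j w)
  then have j: "ga j \<in> grouplikes" by (simp add: ga_grouplike)
  \<comment> \<open>The additional letter \<open>j\<close> contributes one factor
    \<open>ga j\<close>, which commutes to the front. The statement for sublists \<open>is\<close>
    records whether \<open>j\<close> has been met.\<close>
  have step: "prod_list (map (\<lambda>i. ga i ^ count_list (j # w) i) is) =
      (if j \<in> set is then ga j else 1) * prod_list (map (\<lambda>i. ga i ^ count_list w i) is)"
    if "distinct is" "set is \<subseteq> {..<n}" for "is"
    using that
  proof (induction "is")
    case (Cons i "is")
    have "ga i ^ count_list w i * ga j = ga j * ga i ^ count_list w i"
      using Cons.prems j by (intro grouplikes_commute power_grouplike) (auto simp: ga_grouplike)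
    then have comm: "ga i ^ count_list w i * (ga j * x) = ga j * (ga i ^ count_list w i * x)" for x
      by (metis mult.assoc)
    have IH: "prod_list (map (\<lambda>i. ga i ^ count_list (j # w) i) is) =
        (if j \<in> set is then ga j else 1) * prod_list (map (\<lambda>i. ga i ^ count_list w i) is)"
      using Cons by simp
    show ?case
    proof (cases "i = j")
      case True
      with Cons.prems have "j \<notin> set is" by auto
      with IH True show ?thesis by (simp add: mult.assoc)
    next
      case False
      then have "prod_list (map (\<lambda>i. ga i ^ count_list (j # w) i) (i # is)) = ga i ^ count_list w i *
          ((if j \<in> set is then ga j else 1) * prod_list (map (\<lambda>i. ga i ^ count_list w i) is))"
        using IH by simp
      with False comm show ?thesis by simp
    qed
  qed simp
  from step[of "[0..<n]"] Cons show ?case by (simp add: constitution_group_def lessThan_atLeast0)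
next
  case Nil
  have "prod_list (map (\<lambda>i. 1 :: 'a) xs) = 1" for xs :: "nat list" by (induction xs) auto
  then show ?case by (simp add: constitution_group_def)
qed

lemma bichar_count_list:
  assumes "w \<in> alphabet_words"
  shows "bichar (count_list w) (count_list w) = chi_pair w w"
proof -
  have "wchi u (wgrp w) = chi_pair u w" if "u \<in> alphabet_words" for u
    using that
  proof (induction u)
    case (Cons i u)
    with assms chi_wgrp[of i w] show ?case by (simp add: wchi_def wpair_Cons[of _ i u w])
  qed (simp add: wchi_def)
  with assms show ?thesis
    by (simp add: bichar_def constitution_char_wchi constitution_group_wgrp)
qed

theorem pbw_basis_exists:
  "\<exists>U r m h. linear_order_on U r \<and> (\<forall>u\<in>U. has_constitution u (m u)) \<and>
     (\<forall>u\<in>U. admissible_height (bichar (m u) (m u)) (h u)) \<and> pbw_basis U r h"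
proof -
  define U where "U = pbw_gen ` pbw_index"
  define dec where "dec = inv_into pbw_index pbw_gen"
  define r where "r = {(pbw_gen i, pbw_gen j) | i j. i \<in> pbw_index \<and> j \<in> pbw_index \<and> (i = j \<or> index_less i j)}"
  \<comment> \<open>An element may have several constitutions; the word \<open>l^e\<close> behind
    the generator selects one, and p_uu is computed from it.\<close>
  define m where "m u = count_list (case dec u of (l, e) \<Rightarrow> wpow l e)" for u
  define h where "h u = index_height (dec u)" for u
  have dec: "dec (pbw_gen i) = i" if "i \<in> pbw_index" for i
    using that inj_on_pbw_gen by (simp add: dec_def)
  have r_iff: "(pbw_gen i, pbw_gen j) \<in> r \<longleftrightarrow> i = j \<or> index_less i j"
    if "i \<in> pbw_index" "j \<in> pbw_index" for i j
    using that inj_onD[OF inj_on_pbw_gen] unfolding r_def by blast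
  have "linear_order_on U r"
    unfolding linear_order_on_def partial_order_on_def preorder_on_def
  proof (intro conjI)
    show "r \<subseteq> U \<times> U" by (auto simp: r_def U_def)
    show "refl_on U r" by (auto simp: refl_on_def r_def U_def)
    show "trans r"
    proof (rule transI)
      fix x y z assume xy: "(x, y) \<in> r" and yz: "(y, z) \<in> r"
      from xy obtain i j where 1: "x = pbw_gen i" "y = pbw_gen j" "i \<in> pbw_index" "j \<in> pbw_index"
        "i = j \<or> index_less i j" by (auto simp: r_def)
      from yz obtain k where 2: "z = pbw_gen k" "k \<in> pbw_index" by (auto simp: r_def)
      from yz 1 2 r_iff have "j = k \<or> index_less j k" by simp
      with 1 have "i = k \<or> index_less i k" by (auto simp: index_less_def split: prod.splits)
      with 1 2 r_iff show "(x, z) \<in> r" by simp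
    qed
    show "antisym r"
    proof (rule antisymI)
      fix x y assume xy: "(x, y) \<in> r" and yx: "(y, x) \<in> r"
      from xy obtain i j where 1: "x = pbw_gen i" "y = pbw_gen j" "i \<in> pbw_index" "j \<in> pbw_index"
        "i = j \<or> index_less i j" by (auto simp: r_def)
      from yx 1 r_iff have "j = i \<or> index_less j i" by simp
      with 1 show "x = y" by (auto simp: index_less_def split: prod.splits)
    qed
    show "total_on U r"
      unfolding total_on_def
    proof (intro ballI impI)
      fix x y assume "x \<in> U" "y \<in> U"
      then obtain i j where 1: "x = pbw_gen i" "y = pbw_gen j" "i \<in> pbw_index" "j \<in> pbw_index"
        by (auto simp: U_def)
      have "i = j \<or> index_less i j \<or> index_less j i"
        by (auto simp: index_less_def split: prod.splits)
      with 1 r_iff show "(x, y) \<in> r \<or> (y, x) \<in> r" by auto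
    qed
  qed
  moreover have "has_constitution u (m u)" "admissible_height (bichar (m u) (m u)) (h u)"
    if u: "u \<in> U" for u
  proof -
    obtain l e where i: "(l, e) \<in> pbw_index" "u = pbw_gen (l, e)" using u by (auto simp: U_def)
    then have w: "wpow l e \<in> alphabet_words" "gbin_vanish (chi_pair l l) e"
      by (auto simp: pbw_index_def normal_def)
    have m: "m u = count_list (wpow l e)" using i dec by (simp add: m_def)
    show "has_constitution u (m u)"
      using has_constitution_wval[OF w(1)] i m by (simp add: pbw_gen_def)
    have "chi_pair (wpow l e) (wpow l e) = chi_pair l l ^ (e * e)"
      by (simp add: wpair_wpow_left wpair_wpow_right power_mult)
    then show "admissible_height (bichar (m u) (m u)) (h u)"
      using admissible_height_next_vanish[OF w(2)] bichar_count_list[OF w(1)] m i dec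
      by (simp add: h_def index_height_def)
  qed
  moreover have "pbw_basis U r h"
  proof -
    let ?f = "map (map_prod pbw_gen id)"
    have words: "pbw_words U r h = ?f ` index_words"
    proof (intro subset_antisym subsetI)
      fix ws assume ws: "ws \<in> pbw_words U r h"
      define vs where "vs = map (map_prod dec id) ws"
      have gen: "pbw_gen (dec u) = u \<and> dec u \<in> pbw_index" if "u \<in> U" for u
        using that by (auto simp: U_def dec)
      have U: "fst x \<in> U" if "x \<in> set ws" for x using ws that by (auto simp: pbw_words_def)
      have "map (map_prod pbw_gen id) vs = ws"
        unfolding vs_def map_map
        by (rule map_idI) (use U gen in \<open>auto simp: prod_eq_iff\<close>)
      moreover have "vs \<in> index_words"
        unfolding index_words_def
      proof (intro CollectI conjI)
        show "sorted_wrt (\<lambda>x y. index_less (fst x) (fst y)) vs"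
          unfolding vs_def sorted_wrt_map
        proof (rule sorted_wrt_mono_rel)
          show "sorted_wrt (\<lambda>x y. fst x \<noteq> fst y \<and> (fst x, fst y) \<in> r) ws"
            using ws by (simp add: pbw_words_def)
          fix x y assume "x \<in> set ws" "y \<in> set ws" "fst x \<noteq> fst y \<and> (fst x, fst y) \<in> r"
          moreover from this have "dec (fst x) \<noteq> dec (fst y)" using U gen by metis
          ultimately show "index_less (fst (map_prod dec id x)) (fst (map_prod dec id y))"
            using r_iff[of "dec (fst x)" "dec (fst y)"] U gen by auto
        qed
        show "\<forall>(i, d)\<in>set vs. i \<in> pbw_index \<and> 0 < d \<and> enat d < index_height i"
          using ws gen by (fastforce simp: vs_def pbw_words_def h_def)
      qed
      ultimately show "ws \<in> ?f ` index_words" by (metis image_eqI)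
    next
      fix ws assume "ws \<in> ?f ` index_words"
      then obtain vs where vs: "ws = ?f vs" "vs \<in> index_words" by blast
      have I: "fst x \<in> pbw_index" if "x \<in> set vs" for x using vs(2) that by (auto simp: index_words_def)
      show "ws \<in> pbw_words U r h"
        unfolding pbw_words_def
      proof (intro CollectI conjI)
        show "sorted_wrt (\<lambda>x y. fst x \<noteq> fst y \<and> (fst x, fst y) \<in> r) ws"
          unfolding vs(1) sorted_wrt_map
        proof (rule sorted_wrt_mono_rel)
          show "sorted_wrt (\<lambda>x y. index_less (fst x) (fst y)) vs"
            using vs(2) by (simp add: index_words_def)
          fix x y assume xy: "x \<in> set vs" "y \<in> set vs" "index_less (fst x) (fst y)"
          then have "fst x \<noteq> fst y" by (auto simp: index_less_def)
          with xy I r_iff inj_on_pbw_gen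
          show "fst (map_prod pbw_gen id x) \<noteq> fst (map_prod pbw_gen id y) \<and>
              (fst (map_prod pbw_gen id x), fst (map_prod pbw_gen id y)) \<in> r"
            by (auto simp: inj_on_eq_iff)
        qed
        show "\<forall>(u, k)\<in>set ws. u \<in> U \<and> 0 < k \<and> enat k < h u"
          using vs dec by (fastforce simp: index_words_def U_def h_def)
      qed
    qed
    have img: "pbw_product ` (grouplikes \<times> pbw_words U r h) =
        (\<lambda>(g, w). g * wval w) ` (grouplikes \<times> {w. normal w})"
      unfolding words image_index_words[symmetric]
      by (force simp: pbw_product_index_words image_iff)
    have "inj_on pbw_product (grouplikes \<times> pbw_words U r h)"
    proof (rule inj_onI)
      fix x y assume xy: "x \<in> grouplikes \<times> pbw_words U r h" "y \<in> grouplikes \<times> pbw_words U r h"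
        "pbw_product x = pbw_product y"
      then obtain g vs g' vs' where x: "x = (g, ?f vs)" "g \<in> grouplikes" "vs \<in> index_words"
        and y: "y = (g', ?f vs')" "g' \<in> grouplikes" "vs' \<in> index_words" unfolding words by blast
      have "(g, concat (index_fact vs)) = (g', concat (index_fact vs'))"
        by (rule inj_onD[OF inj_on_normal_family])
          (use xy x y normal_index_words in \<open>auto simp: pbw_product_index_words\<close>)
      with inj_onD[OF inj_on_index_words, of vs vs'] x y show "x = y" by simp
    qed
    moreover have "(\<lambda>(g, w). g * wval w) ` (grouplikes \<times> {w. normal w}) = gwords {w. normal w}"
      by (auto simp: gwords_def)
    ultimately show ?thesis
      unfolding pbw_basis_def img using independent_normal_family span_gwords_normal by simp
  qed
  ultimately show ?thesis by blast
qed

end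

theorem theorem4p1:
  fixes scale :: "'k::field \<Rightarrow> 'a::ring_1 \<Rightarrow> 'a"
    and comult :: "'a \<Rightarrow> ('a \<times> 'a) list"
    and counit :: "'a \<Rightarrow> 'k"
    and antipode :: "'a \<Rightarrow> 'a"
    and n :: nat
    and a :: "nat \<Rightarrow> 'a"
    and ga :: "nat \<Rightarrow> 'a"
    and chi :: "nat \<Rightarrow> 'a \<Rightarrow> 'k"
  assumes "character_hopf_algebra scale comult counit antipode n a ga chi"
  shows "\<exists>(U :: 'a set) (r :: 'a rel) (m :: 'a \<Rightarrow> nat \<Rightarrow> nat) (h :: 'a \<Rightarrow> enat).
    linear_order_on U r \<and>
    (\<forall>u\<in>U. character_hopf_algebra.has_constitution scale n a u (m u)) \<and>
    (\<forall>u\<in>U. admissible_height (character_hopf_algebra.bichar n ga chi (m u) (m u)) (h u)) \<and>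
    hopf_algebra.pbw_basis scale comult counit U r h"
  by (rule character_hopf_algebra.pbw_basis_exists[OF assms])

end
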